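(* Let $G$ be a connected multigraph with at least one cycle and at least two vertices, and let $t$ be a positive integer. If there is an edge set $F_0\subseteq E(G)$ satisfying $|E(G)|-|F_0|<t\cdot\tau(F_0)$, then $ar_{bc}(G,t)=|E(G)|$. Otherwise, $$ar_{bc}(G,t)=\max_{F\colon \tau(F)\geq 2}\{|F|+t\,(\tau(F)-1)\},$$ where the maximum is taken over all edge sets $F\subseteq E(G)$ with $\tau(F)\geq 2$.
   Context: For $F\subseteq E(G)$, $\tau(F)$ is the number of connected components of the spanning subgraph $(V(G),F)$ that are trees (isolated vertices count as trees). A unicyclic subgraph here means a spanning subgraph of $G$ (on all of $V(G)$) each of whose connected components contains exactly one cycle; these are exactly the bases of the bicircular matroid of $G$, whose independent sets are the edge sets in which every component has at most one cycle. Given a coloring of $E(G)$, a subgraph is rainbow if its edges have pairwise distinct colors. $ar_{bc}(G,t)$ is the maximum number $m$ such that there is a coloring of $E(G)$ with exactly $m$ colors containing no $t$ pairwise edge-disjoint rainbow unicyclic subgraphs. *)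

theory Defs
  imports Main
begin

text \<open>
  Undirected multigraphs with parallel edges and loops; edges are abstract, and \<^term>\<open>mends G e\<close>
  is the set of endpoints of \<^term>\<open>e\<close>, a singleton when \<^term>\<open>e\<close> is a loop.
\<close>

record ('v, 'e) mgraph =
  mverts :: "'v set"
  medges :: "'e set"
  mends :: "'e \<Rightarrow> 'v set"

definition multigraph :: "('v, 'e) mgraph \<Rightarrow> bool" where
  "multigraph G \<longleftrightarrow> finite (mverts G) \<and> finite (medges G) \<and>
     (\<forall>e\<in>medges G. mends G e \<subseteq> mverts G \<and> card (mends G e) \<in> {1, 2})"

definition reachable :: "('v, 'e) mgraph \<Rightarrow> ('v \<times> 'v) set" where
  "reachable G = {(u, v). \<exists>e\<in>medges G. mends G e = {u, v}}\<^sup>* \<inter> mverts G \<times> mverts G"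

definition mconnected :: "('v, 'e) mgraph \<Rightarrow> bool" where
  "mconnected G \<longleftrightarrow> mverts G \<noteq> {} \<and> (\<forall>u\<in>mverts G. \<forall>v\<in>mverts G. (u, v) \<in> reachable G)"

definition induced_subgraph :: "('v, 'e) mgraph \<Rightarrow> 'v set \<Rightarrow> ('v, 'e) mgraph" where
  "induced_subgraph G X = G\<lparr>mverts := X, medges := {e \<in> medges G. mends G e \<subseteq> X}\<rparr>"

definition spanning_subgraph :: "('v, 'e) mgraph \<Rightarrow> 'e set \<Rightarrow> ('v, 'e) mgraph" where
  "spanning_subgraph G F = G\<lparr>medges := F\<rparr>"

definition components :: "('v, 'e) mgraph \<Rightarrow> ('v, 'e) mgraph set" where
  "components G = induced_subgraph G ` (mverts G // reachable G)"

text \<open>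
  A cycle is identified with its edge set. A loop is a cycle of length 1 and a pair of parallel
  edges is a cycle of length 2 (distinctness of \<^term>\<open>es\<close> matters only for that length).
\<close>

definition is_cycle :: "('v, 'e) mgraph \<Rightarrow> 'e set \<Rightarrow> bool" where
  "is_cycle G C \<longleftrightarrow> (\<exists>vs es. vs \<noteq> [] \<and> length es = length vs \<and> distinct vs \<and> distinct es \<and>
     set vs \<subseteq> mverts G \<and> set es \<subseteq> medges G \<and>
     (\<forall>i<length vs. mends G (es ! i) = {vs ! i, vs ! (Suc i mod length vs)}) \<and> C = set es)"

definition is_tree :: "('v, 'e) mgraph \<Rightarrow> bool" where
  "is_tree G \<longleftrightarrow> mconnected G \<and> (\<nexists>C. is_cycle G C)"

definition tau :: "('v, 'e) mgraph \<Rightarrow> 'e set \<Rightarrow> nat" where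
  "tau G F = card {H \<in> components (spanning_subgraph G F). is_tree H}"

definition unicyclic :: "('v, 'e) mgraph \<Rightarrow> 'e set \<Rightarrow> bool" where
  "unicyclic G B \<longleftrightarrow> B \<subseteq> medges G \<and>
     (\<forall>H\<in>components (spanning_subgraph G B). \<exists>!C. is_cycle H C)"

definition rainbow :: "('e \<Rightarrow> 'c) \<Rightarrow> 'e set \<Rightarrow> bool" where
  "rainbow c B \<longleftrightarrow> inj_on c B"

definition has_disjoint_rainbow_unicyclic ::
  "('v, 'e) mgraph \<Rightarrow> ('e \<Rightarrow> 'c) \<Rightarrow> nat \<Rightarrow> bool" where
  "has_disjoint_rainbow_unicyclic G c t \<longleftrightarrow>
     (\<exists>B :: nat \<Rightarrow> 'e set. (\<forall>i<t. unicyclic G (B i) \<and> rainbow c (B i)) \<and>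
        (\<forall>i<t. \<forall>j<t. i \<noteq> j \<longrightarrow> B i \<inter> B j = {}))"

definition ar_bc :: "('v, 'e) mgraph \<Rightarrow> nat \<Rightarrow> nat" where
  "ar_bc G t = Max {m. \<exists>c :: 'e \<Rightarrow> nat. card (c ` medges G) = m \<and>
     \<not> has_disjoint_rainbow_unicyclic G c t}"

end

theory Submission
  imports Defs
begin

text \<open>
  The function \<open>r F = |V| - \<tau>(F)\<close> is the rank function of the bicircular matroid, whose bases are
  the unicyclic subgraphs; so the claim is one about packing rainbow bases of a matroid. Suppose
  a colouring of \<open>E\<close> has more colours than the right-hand side. By Rado's theorem there is a rainbow
  set \<open>R\<close> of at least \<open>t r(E) - t + 1\<close> elements with \<open>|J| \<le> t r(J)\<close> for all \<open>J \<subseteq> R\<close>. It extends to a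
  set \<open>U\<close> of \<open>t r(E)\<close> elements with the same property, and \<open>U\<close> splits into \<open>t\<close> disjoint bases. As \<open>U\<close>
  misses being rainbow by at most \<open>t - 1\<close> repetitions, a base with a repeated colour always has a
  partner base with which it shares no colour, and symmetric exchanges between such pairs make
  all the bases rainbow.
\<close>

section \<open>Rado's theorem and sparse sets for submodular functions\<close>

text \<open>The defect \<open>t - 1\<close> comes from the sets of corank one. Put
  \<open>s = r E - r X\<close>. For a rainbow sparse set of size \<open>q\<close>, Rado's condition
  asks for \<open>q - t * r X\<close> colours outside each \<open>X\<close>. For
  \<open>s \<ge> 2\<close>, having more than \<open>card X + t * (s - 1)\<close> colours in total
  leaves at least \<open>t * (s - 1) + 1\<close> of them outside \<open>X\<close>. The maximum in
  the claim ranges over \<open>tau G F \<ge> 2\<close>, so for \<open>s = 1\<close> the number of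
  colours gives nothing; the packing condition supplies \<open>t\<close> elements outside
  \<open>X\<close>, but they may all have the same colour. Both cases allow exactly
  \<open>q = t * r E - t + 1\<close>. Hence colours may be repeated between different bases, and
  only the repetitions within one base have to be removed.

  The condition that separates the two cases of the claim is Edmonds' condition for \<open>t\<close>
  disjoint bases. Where it fails, no colouring has \<open>t\<close> disjoint rainbow bases, and an
  injective one is extremal.\<close>

text \<open>Rado's argument: as long as some set has two elements, one of them can be deleted
  without violating the rank condition. Allowing any monotone submodular \<open>g\<close> covers
  both uses: a rank function plus a constant defect, and the rank of a direct sum of copies of a
  matroid.\<close>

lemma rado_selection:
  fixes g :: "'a set \<Rightarrow> nat" and A :: "'k \<Rightarrow> 'a set"
  assumes mono: "\<And>X Y. X \<subseteq> Y \<Longrightarrow> g X \<le> g Y"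
    and submod: "\<And>X Y. g (X \<union> Y) + g (X \<inter> Y) \<le> g X + g Y"
    and K: "finite K"
    and A: "\<And>k. k \<in> K \<Longrightarrow> finite (A k) \<and> A k \<noteq> {}"
    and rank: "\<And>J. J \<subseteq> K \<Longrightarrow> card J \<le> g (\<Union> (A ` J))"
  shows "\<exists>a. (\<forall>k\<in>K. a k \<in> A k) \<and> (\<forall>J\<subseteq>K. card J \<le> g (a ` J))"
  using A rank
proof (induction "\<Sum>k\<in>K. card (A k)" arbitrary: A rule: less_induct)
  case (less A)
  show ?case
  proof (cases "\<forall>k\<in>K. \<exists>x. A k = {x}")
    case True
    then obtain a where a: "\<And>k. k \<in> K \<Longrightarrow> A k = {a k}" by metis
    have "\<Union> (A ` J) = a ` J" if "J \<subseteq> K" for J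
      using a that by fastforce
    then show ?thesis using a less.prems(2) by (intro exI[of _ a]) auto
  next
    case False
    then obtain k where k: "k \<in> K" "\<nexists>x. A k = {x}" by auto
    obtain x where x: "x \<in> A k" using less.prems(1) k by blast
    obtain y where y: "y \<in> A k" "y \<noteq> x" using x k(2) by blast
    define D where "D z = A(k := A k - {z})" for z
    \<comment> \<open>If deleting \<open>z\<close> kept the rank condition, induction would give a
      selection. So some \<open>J\<close> violates it; it contains \<open>k\<close>, and dropping
      \<open>k\<close> from \<open>J\<close> turns the strict inequality into a weak one.\<close>
    have *: "\<exists>J. J \<subseteq> K - {k} \<and> g (A k - {z} \<union> \<Union> (A ` J)) \<le> card J"
      if z: "z \<in> A k" and "A k \<noteq> {z}"
        and no: "\<not> (\<exists>a. (\<forall>k\<in>K. a k \<in> A k) \<and> (\<forall>J\<subseteq>K. card J \<le> g (a ` J)))" for z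
    proof -
      have sm: "(\<Sum>k\<in>K. card (D z k)) < (\<Sum>k\<in>K. card (A k))"
      proof (rule sum_strict_mono_ex1[OF K])
        show "\<forall>i\<in>K. card (D z i) \<le> card (A i)"
          using less.prems(1) by (auto simp: D_def intro: card_mono)
        show "\<exists>i\<in>K. card (D z i) < card (A i)"
          using k(1) z less.prems(1)[OF k(1)]
          by (intro bexI[of _ k]) (auto simp: D_def card_gt_0_iff)
      qed
      have fin: "finite (D z i) \<and> D z i \<noteq> {}" if "i \<in> K" for i
        using less.prems(1)[OF that] z \<open>A k \<noteq> {z}\<close> by (auto simp: D_def)
      have "\<not> (\<forall>J\<subseteq>K. card J \<le> g (\<Union> (D z ` J)))"
      proof
        assume "\<forall>J\<subseteq>K. card J \<le> g (\<Union> (D z ` J))"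
        then obtain a where a: "\<forall>i\<in>K. a i \<in> D z i" "\<forall>J\<subseteq>K. card J \<le> g (a ` J)"
          using less.hyps[OF sm fin] by auto
        have "a i \<in> A i" if "i \<in> K" for i
          using a(1) that by (auto simp: D_def split: if_splits)
        then show False using no a(2) by blast
      qed
      then obtain J where J: "J \<subseteq> K" "g (\<Union> (D z ` J)) < card J" by (auto simp: not_le)
      have kJ: "k \<in> J"
      proof (rule ccontr)
        assume "k \<notin> J"
        then have "D z ` J = A ` J" by (auto simp: D_def)
        then show False using J less.prems(2)[OF J(1)] by simp
      qed
      have "\<Union> (D z ` J) = A k - {z} \<union> \<Union> (A ` (J - {k}))"
        using kJ by (auto simp: D_def split: if_splits)
      moreover have "card (J - {k}) = card J - 1" using kJ by simp
      ultimately show ?thesis using J by (intro exI[of _ "J - {k}"]) auto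
    qed
    show ?thesis
    proof (rule ccontr)
      assume no: "\<not> ?thesis"
      obtain J1 where J1: "J1 \<subseteq> K - {k}" "g (A k - {x} \<union> \<Union> (A ` J1)) \<le> card J1"
        using *[OF x _ no] k(2) by blast
      obtain J2 where J2: "J2 \<subseteq> K - {k}" "g (A k - {y} \<union> \<Union> (A ` J2)) \<le> card J2"
        using *[OF y(1) _ no] k(2) by blast
      \<comment> \<open>Uncrossing the two violations: as \<open>x\<close> and \<open>y\<close>
        differ, the union recovers all of \<open>A k\<close> and counts one index more than
        \<open>J1 \<union> J2\<close>, while the intersection contains all sets indexed by
        \<open>J1 \<inter> J2\<close>. Submodularity fails by one.\<close>
      let ?P = "A k - {x} \<union> \<Union> (A ` J1)" and ?Q = "A k - {y} \<union> \<Union> (A ` J2)"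
      have fJ: "finite J1" "finite J2" using J1 J2 K by (auto intro: finite_subset)
      have "?P \<union> ?Q = \<Union> (A ` insert k (J1 \<union> J2))" using x y by auto
      moreover have "insert k (J1 \<union> J2) \<subseteq> K" using J1 J2 k(1) by blast
      ultimately have "card (insert k (J1 \<union> J2)) \<le> g (?P \<union> ?Q)" using less.prems(2) by metis
      then have 1: "card (J1 \<union> J2) + 1 \<le> g (?P \<union> ?Q)"
        using J1 J2 fJ by (subst (asm) card_insert_disjoint) auto
      have "card (J1 \<inter> J2) \<le> g (\<Union> (A ` (J1 \<inter> J2)))" using less.prems(2) J1 by blast
      also have "\<dots> \<le> g (?P \<inter> ?Q)" by (rule mono) auto
      finally show False
        using 1 submod[of ?P ?Q] J1(2) J2(2) card_Un_Int[OF fJ] by linarith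
    qed
  qed
qed

text \<open>Gains diminish: \<open>insert e A\<close> and \<open>B\<close> have union
  \<open>insert e B\<close> and an intersection containing \<open>A\<close>. This replaces the
  closure operator in all spanning arguments below.\<close>

lemma submodular_insert_absorb:
  fixes g :: "'a set \<Rightarrow> nat"
  assumes mono: "\<And>X Y. X \<subseteq> Y \<Longrightarrow> g X \<le> g Y"
    and submod: "\<And>X Y. g (X \<union> Y) + g (X \<inter> Y) \<le> g X + g Y"
    and "A \<subseteq> B" "g (insert e A) \<le> g A"
  shows "g (insert e B) \<le> g B"
proof -
  have "insert e A \<union> B = insert e B" using assms(3) by auto
  then show ?thesis
    using submod[of "insert e A" B] mono[of A "insert e A \<inter> B"] assms(3,4)
    by (simp add: subset_insertI)
qed

text \<open>
  The sets satisfying \<open>sparse g\<close> are the independent sets of the matroid that a monotone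
  submodular \<open>g\<close> induces.
\<close>

definition sparse :: "('a set \<Rightarrow> nat) \<Rightarrow> 'a set \<Rightarrow> bool" where
  "sparse g I \<longleftrightarrow> (\<forall>J\<subseteq>I. card J \<le> g J)"

text \<open>The set \<open>X\<close> certifies the size of \<open>I\<close>: every sparse subset of
  \<open>W\<close> obeys the reverse inequality for every \<open>X\<close>, so extending any sparse
  \<open>S\<close> reaches the overall maximum. The certificate is the largest tight set together
  with \<open>W - I\<close>, all of whose elements it absorbs.\<close>

lemma sparse_extension:
  fixes g :: "'a set \<Rightarrow> nat"
  assumes mono: "\<And>X Y. X \<subseteq> Y \<Longrightarrow> g X \<le> g Y"
    and submod: "\<And>X Y. g (X \<union> Y) + g (X \<inter> Y) \<le> g X + g Y"
    and empty: "g {} = 0"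
    and W: "finite W" and S: "S \<subseteq> W" "sparse g S"
  shows "\<exists>I X. S \<subseteq> I \<and> I \<subseteq> W \<and> sparse g I \<and> X \<subseteq> W \<and> card I \<ge> g X + card (W - X)"
proof -
  let ?Q = "\<lambda>I. S \<subseteq> I \<and> I \<subseteq> W \<and> sparse g I"
  have "?Q S" using S by simp
  moreover have "\<forall>I. ?Q I \<longrightarrow> card I < Suc (card W)"
    using W by (auto simp: less_Suc_eq_le intro: card_mono)
  ultimately have "\<exists>I. ?Q I \<and> (\<forall>J. ?Q J \<longrightarrow> card J \<le> card I)"
    by (rule Lattices_Big.ex_has_greatest_nat)
  then obtain I where I: "?Q I" and max: "\<And>J. ?Q J \<Longrightarrow> card J \<le> card I" by blast
  have fI: "finite I" using I W by (meson finite_subset)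
  define tight where "tight J \<longleftrightarrow> J \<subseteq> I \<and> g J \<le> card J" for J
  have sp: "card J \<le> g J" if "J \<subseteq> I" for J using I that by (auto simp: sparse_def)
  have tight_Un: "tight (J1 \<union> J2)" if "tight J1" "tight J2" for J1 J2
  proof -
    have f: "finite J1" "finite J2" using that fI by (meson finite_subset tight_def)+
    have "card (J1 \<inter> J2) \<le> g (J1 \<inter> J2)" using that by (intro sp) (auto simp: tight_def)
    then show ?thesis using submod[of J1 J2] that card_Un_Int[OF f] by (auto simp: tight_def)
  qed
  \<comment> \<open>Maximality of \<open>I\<close> yields a violating \<open>J\<close> inside
    \<open>insert e I\<close>. It contains \<open>e\<close>, and
    \<open>g J \<le> card (J - {e}) \<le> g (J - {e})\<close> makes \<open>J - {e}\<close> tight and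
    shows that it absorbs \<open>e\<close>.\<close>
  have ex: "\<exists>J. tight J \<and> g (insert e J) \<le> g J" if e: "e \<in> W - I" for e
  proof -
    have "card (insert e I) > card I" using e fI by simp
    then have "\<not> sparse g (insert e I)" using max[of "insert e I"] e I by auto
    then obtain J where J: "J \<subseteq> insert e I" "g J < card J" by (auto simp: sparse_def not_le)
    have "e \<in> J" using J sp by (metis leD subset_insert)
    then have J': "J - {e} \<subseteq> I" "insert e (J - {e}) = J" using J by auto
    have "card J = Suc (card (J - {e}))"
      using J' fI \<open>e \<in> J\<close> by (metis card.remove finite_insert finite_subset J(1))
    moreover have "g (J - {e}) \<le> g J" by (rule mono) auto
    ultimately show ?thesis using J J' sp[OF J'(1)]
      by (intro exI[of _ "J - {e}"]) (auto simp: tight_def)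
  qed
  have "tight {}" using empty by (simp add: tight_def)
  moreover have "\<forall>J. tight J \<longrightarrow> card J < Suc (card I)"
    using fI by (auto simp: tight_def less_Suc_eq_le intro: card_mono)
  ultimately have "\<exists>T. tight T \<and> (\<forall>J. tight J \<longrightarrow> card J \<le> card T)"
    by (rule Lattices_Big.ex_has_greatest_nat)
  then obtain T where T: "tight T" and Tmax: "\<And>J. tight J \<Longrightarrow> card J \<le> card T" by blast
  have sub: "J \<subseteq> T" if "tight J" for J
  proof -
    have "finite (J \<union> T)" using that T fI by (meson finite_UnI finite_subset tight_def)
    then have "T = J \<union> T" using Tmax[OF tight_Un[OF that T]] by (intro card_seteq) auto
    then show ?thesis by blast
  qed
  have absorb: "g (T \<union> D) \<le> g T" if "D \<subseteq> W - I" "finite D" for D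
    using that(2,1)
  proof (induction D rule: finite_induct)
    case empty
    then show ?case by simp
  next
    case (insert e D)
    obtain J where J: "tight J" "g (insert e J) \<le> g J" using ex insert.prems by blast
    have "g (insert e (T \<union> D)) \<le> g (T \<union> D)"
      by (rule submodular_insert_absorb[OF mono submod, of J]) (use J sub in auto)
    then show ?case using insert by simp
  qed
  define X where "X = T \<union> (W - I)"
  have "g X \<le> card T" using absorb[of "W - I"] T W unfolding X_def tight_def by force
  moreover have "W - X = I - T" using I T by (auto simp: X_def tight_def)
  moreover have "card I = card T + card (I - T)"
    using T fI card_Diff_subset[of T I] card_mono[of I T] finite_subset[of T I] by (simp add: tight_def)
  ultimately have "g X + card (W - X) \<le> card I" by simp
  moreover have "X \<subseteq> W" using I T by (auto simp: X_def tight_def)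
  ultimately show ?thesis using I by blast
qed

section \<open>Packing rainbow bases of a matroid\<close>

locale matroid_rank =
  fixes E :: "'e set" and r :: "'e set \<Rightarrow> nat"
  assumes finite_E: "finite E"
    and r_mono: "X \<subseteq> Y \<Longrightarrow> r X \<le> r Y"
    and r_submodular: "r (X \<union> Y) + r (X \<inter> Y) \<le> r X + r Y"
    and r_le_card: "finite X \<Longrightarrow> r X \<le> card X"
begin

section \<open>Bases, independent sets and exchange\<close>

definition is_base :: "'e set \<Rightarrow> bool" where
  "is_base B \<longleftrightarrow> B \<subseteq> E \<and> r B = r E \<and> card B = r E"

definition has_rainbow_bases :: "('e \<Rightarrow> 'c) \<Rightarrow> nat \<Rightarrow> bool" where
  "has_rainbow_bases c t \<longleftrightarrow> (\<exists>B :: nat \<Rightarrow> 'e set. (\<forall>i<t. is_base (B i) \<and> inj_on c (B i)) \<and>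
     (\<forall>i<t. \<forall>j<t. i \<noteq> j \<longrightarrow> B i \<inter> B j = {}))"

lemma r_empty: "r {} = 0"
  using r_le_card[of "{}"] by simp

lemma r_le_rank: "X \<subseteq> E \<Longrightarrow> r X \<le> r E"
  by (rule r_mono)

lemma base_finite: "is_base B \<Longrightarrow> finite B"
  using finite_E by (meson finite_subset is_base_def)

lemma r_insert_le: "r (insert x X) \<le> Suc (r X)"
proof -
  have "r (X \<union> {x}) \<le> r X + r {x}" using r_submodular[of X "{x}"] by linarith
  then show ?thesis using r_le_card[of "{x}"] by simp
qed

lemma r_Un_absorb:
  assumes "finite D" "\<And>x. x \<in> D \<Longrightarrow> r (insert x X) = r X"
  shows "r (X \<union> D) = r X"
  using assms
proof (induction D rule: finite_induct)
  case (insert x D)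
  have "r (insert x (X \<union> D)) \<le> r (X \<union> D)"
    by (rule submodular_insert_absorb[OF r_mono r_submodular, of X]) (use insert.prems in auto)
  then show ?case using insert r_mono[of "X" "insert x (X \<union> D)"] by (simp add: subset_insertI2)
qed simp

lemma r_independent_subset:
  assumes "finite B" "r B = card B" "I \<subseteq> B"
  shows "r I = card I"
proof -
  have "r (I \<union> (B - I)) \<le> r I + r (B - I)" using r_submodular[of I "B - I"] by linarith
  moreover have "I \<union> (B - I) = B" using assms by auto
  moreover have "r (B - I) \<le> card (B - I)" "r I \<le> card I"
    using assms by (meson r_le_card finite_Diff finite_subset)+
  moreover have "card B = card I + card (B - I)"
    using assms card_Diff_subset[of I B] card_mono[of B I] finite_subset[of I B] by simp
  ultimately show ?thesis using assms(2) by simp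
qed

text \<open>Building up \<open>B\<close> one element at a time, each step gains one: an element
  without gain over a part of \<open>B\<close> would have none over the rest of \<open>B\<close>
  either and would be redundant.\<close>

lemma r_eq_card_if_no_redundant_element:
  assumes B: "finite B" and red: "\<And>e. e \<in> B \<Longrightarrow> r (B - {e}) \<noteq> r B"
  shows "r B = card B"
proof -
  have "r I = card I" if "I \<subseteq> B" for I
  proof -
    have "finite I" using that B finite_subset by blast
    then show ?thesis using that
    proof (induction I rule: finite_induct)
      case empty
      then show ?case using r_empty by simp
    next
      case (insert e I)
      have "\<not> r (insert e I) \<le> r I"
      proof
        assume le: "r (insert e I) \<le> r I"
        have e: "e \<in> B" and eq: "insert e (B - {e}) = B" using insert.prems by auto
        have "r (insert e (B - {e})) \<le> r (B - {e})"
          by (rule submodular_insert_absorb[OF r_mono r_submodular _ le]) (use insert in auto)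
        then have "r B \<le> r (B - {e})" unfolding eq .
        then show False using red[OF e] r_mono[OF Diff_subset, of B "{e}"] by linarith
      qed
      then show ?case using r_insert_le[of e I] insert by simp
    qed
  qed
  then show ?thesis by blast
qed

text \<open>A base meets \<open>F\<close> in an independent set, hence in at most \<open>r F\<close>
  elements. Both constructions of colourings without rainbow bases rest on this count.\<close>

lemma card_base_Diff:
  assumes "is_base B" "F \<subseteq> E"
  shows "r E - r F \<le> card (B - F)"
proof -
  have "r (B \<inter> F) = card (B \<inter> F)"
    using r_independent_subset[of B] base_finite[OF assms(1)] assms by (auto simp: is_base_def)
  moreover have "r (B \<inter> F) \<le> r F" by (rule r_mono) auto
  moreover have "card B = card (B \<inter> F) + card (B - F)"
    using base_finite[OF assms(1)] by (metis card_Int_Diff)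
  ultimately show ?thesis using assms by (auto simp: is_base_def)
qed

text \<open>A smallest \<open>C \<subseteq> B2\<close> spanning \<open>a\<close> is the fundamental
  circuit of \<open>a\<close> without \<open>a\<close>. If \<open>B1 - {a}\<close> spanned all of
  \<open>C\<close>, it would span \<open>a\<close>; an element \<open>y\<close> of \<open>C\<close>
  that it does not span serves for both exchanges.\<close>

lemma symmetric_exchange:
  assumes B1: "is_base B1" and B2: "is_base B2" and a: "a \<in> B1" "a \<notin> B2"
  shows "\<exists>y\<in>B2 - B1. is_base (insert y (B1 - {a})) \<and> is_base (insert a (B2 - {y}))"
proof -
  have fin: "finite B1" "finite B2" using B1 B2 base_finite by auto
  have sub: "B1 \<subseteq> E" "B2 \<subseteq> E" using B1 B2 by (auto simp: is_base_def)
  let ?S = "\<lambda>Y. Y \<subseteq> B2 \<and> r (insert a Y) = r Y"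
  have "r (insert a B2) \<le> r E" using sub a by (intro r_mono) auto
  then have "?S B2" using B2 r_mono[of B2 "insert a B2"] by (simp add: is_base_def subset_insertI)
  then have "\<exists>C. ?S C \<and> (\<forall>Y. ?S Y \<longrightarrow> card C \<le> card Y)" by (rule ex_has_least_nat)
  then obtain C where C: "?S C" and Cmin: "\<And>Y. ?S Y \<Longrightarrow> card C \<le> card Y" by blast
  have fC: "finite C" using C fin by (meson finite_subset)
  have B1c: "r B1 = card B1" "card B1 > 0"
    using B1 fin a card_gt_0_iff[of B1] by (auto simp: is_base_def)
  have B1': "r (B1 - {a}) = card B1 - 1"
    using r_independent_subset[of B1 "B1 - {a}"] fin B1c a by simp
  have "\<exists>y\<in>C. r (insert y (B1 - {a})) \<noteq> r (B1 - {a})"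
  proof (rule ccontr)
    assume "\<not> ?thesis"
    then have eq: "r (B1 - {a} \<union> C) = r (B1 - {a})" using fC by (intro r_Un_absorb) auto
    have "r (insert a (B1 - {a} \<union> C)) \<le> r (B1 - {a} \<union> C)"
      by (rule submodular_insert_absorb[OF r_mono r_submodular, of C]) (use C in auto)
    moreover have "r B1 \<le> r (insert a (B1 - {a} \<union> C))" by (rule r_mono) auto
    ultimately show False using eq B1' B1c by linarith
  qed
  then obtain y where y: "y \<in> C" "r (insert y (B1 - {a})) \<noteq> r (B1 - {a})" by blast
  have yB: "y \<in> B2" "y \<noteq> a" using y C a by auto
  have ynot: "y \<notin> B1"
  proof
    assume "y \<in> B1"
    then have "insert y (B1 - {a}) = B1 - {a}" using yB by auto
    then show False using y by simp
  qed
  have "r (insert y (B1 - {a})) \<ge> card B1"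
    using y(2) r_mono[OF subset_insertI, of "B1 - {a}" y] B1' B1c by linarith
  moreover have "insert y (B1 - {a}) \<subseteq> E" using sub yB by auto
  moreover have "card (insert y (B1 - {a})) = card B1" using ynot fin a B1c by simp
  ultimately have 1: "is_base (insert y (B1 - {a}))"
    using B1 r_le_rank[of "insert y (B1 - {a})"] by (auto simp: is_base_def)
  \<comment> \<open>By minimality of \<open>C\<close>, adding \<open>a\<close> to
    \<open>C - {y}\<close> raises the rank, back to at least that of \<open>C\<close>. So
    \<open>insert a (C - {y})\<close> spans \<open>y\<close>, and with it
    \<open>insert a (B2 - {y})\<close> does.\<close>
  have "card (C - {y}) < card C" using y fC by (meson card_Diff1_less)
  then have "r (insert a (C - {y})) \<noteq> r (C - {y})" using Cmin[of "C - {y}"] C by auto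
  then have "r (insert a (C - {y})) > r (C - {y})"
    using r_mono[OF subset_insertI, of "C - {y}" a] by linarith
  moreover have "r C \<le> Suc (r (C - {y}))" using r_insert_le[of y "C - {y}"] y by (simp add: insert_absorb)
  moreover have "insert y (insert a (C - {y})) = insert a C" using y by auto
  ultimately have "r (insert y (insert a (C - {y}))) \<le> r (insert a (C - {y}))" using C by simp
  then have "r (insert y (insert a (B2 - {y}))) \<le> r (insert a (B2 - {y}))"
    using submodular_insert_absorb[OF r_mono r_submodular, of "insert a (C - {y})" "insert a (B2 - {y})" y] C
    by blast
  moreover have "r B2 \<le> r (insert y (insert a (B2 - {y})))" by (rule r_mono) auto
  moreover have "insert a (B2 - {y}) \<subseteq> E" using sub a by auto
  moreover have "card (insert a (B2 - {y})) = card B2"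
    using a fin yB by (simp add: card_gt_0_iff) (metis Suc_pred card_gt_0_iff empty_iff)
  ultimately have "is_base (insert a (B2 - {y}))"
    using B2 r_le_rank[of "insert a (B2 - {y})"] by (auto simp: is_base_def)
  then show ?thesis using 1 yB ynot by blast
qed

text \<open>
  A base with a repeated colour has an exchange partner sharing no colour with it: otherwise the
  repetition and one element of each of the other \<open>t - 1\<close> bases could be dropped without losing
  a colour. A symmetric exchange with that partner removes a repetition and creates none.
\<close>

lemma rainbow_bases_of_partition:
  fixes B :: "nat \<Rightarrow> 'e set" and c :: "'e \<Rightarrow> 'c"
  assumes "\<And>i. i < t \<Longrightarrow> is_base (B i)"
    and "\<And>i j. i < t \<Longrightarrow> j < t \<Longrightarrow> i \<noteq> j \<Longrightarrow> B i \<inter> B j = {}"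
    and "(\<Union>i<t. B i) = U"
    and excess: "card U < card (c ` U) + t"
  shows "has_rainbow_bases c t"
  using assms(1-3)
proof (induction "\<Sum>i<t. card (B i) - card (c ` B i)" arbitrary: B rule: less_induct)
  case (less B)
  note base = less.prems(1) and disj = less.prems(2) and U = less.prems(3)
  have finB: "finite (B i)" if "i < t" for i using base base_finite that by blast
  have finU: "finite U" using U finB by auto
  show ?case
  proof (cases "\<forall>i<t. inj_on c (B i)")
    case True
    then show ?thesis using base disj unfolding has_rainbow_bases_def by blast
  next
    case False
    then obtain i a a' where i: "i < t" and a: "a \<in> B i" "a' \<in> B i" "a \<noteq> a'" "c a = c a'"
      by (auto simp: inj_on_def)
    have "\<exists>j<t. j \<noteq> i \<and> c ` B i \<inter> c ` B j = {}"
    proof (rule ccontr)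
      assume no: "\<not> ?thesis"
      have "\<forall>j\<in>{..<t} - {i}. \<exists>y. y \<in> B j \<and> c y \<in> c ` B i"
      proof
        fix j assume "j \<in> {..<t} - {i}"
        then have "c ` B i \<inter> c ` B j \<noteq> {}" using no by (metis DiffE lessThan_iff singletonI)
        then obtain k where k: "k \<in> c ` B i" "k \<in> c ` B j" by blast
        then obtain y where "y \<in> B j" "k = c y" by auto
        then show "\<exists>y. y \<in> B j \<and> c y \<in> c ` B i" using k(1) by blast
      qed
      then obtain y where y: "\<And>j. j \<in> {..<t} - {i} \<Longrightarrow> y j \<in> B j \<and> c (y j) \<in> c ` B i" by metis
      define D where "D = insert a (y ` ({..<t} - {i}))"
      have inj: "inj_on y ({..<t} - {i})"
      proof (rule inj_onI)
        fix j k assume j: "j \<in> {..<t} - {i}" and k: "k \<in> {..<t} - {i}" and "y j = y k"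
        then have "y j \<in> B j \<inter> B k" using y[OF j] y[OF k] by auto
        then show "j = k" using disj[of j k] j k by auto
      qed
      have anot: "a \<notin> y ` ({..<t} - {i})"
      proof
        assume "a \<in> y ` ({..<t} - {i})"
        then obtain j where j: "j \<in> {..<t} - {i}" "a = y j" by auto
        then have "a \<in> B i \<inter> B j" using y a by auto
        then show False using disj[of i j] i j by auto
      qed
      have "card D = t" using inj anot i by (simp add: D_def card_image)
      have DU: "D \<subseteq> U" using y a i U by (auto simp: D_def)
      \<comment> \<open>The only element of \<open>B i\<close> in \<open>D\<close> is
        \<open>a\<close>, and \<open>a'\<close> keeps its colour.\<close>
      have Bi: "c ` B i \<subseteq> c ` (U - D)"
      proof
        fix k assume "k \<in> c ` B i"
        then obtain b where b: "b \<in> B i" "k = c b" "b \<noteq> a" using a by (metis imageE)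
        have "b \<notin> D"
        proof
          assume "b \<in> D"
          then obtain j where j: "j \<in> {..<t} - {i}" "b = y j" using b by (auto simp: D_def)
          then have "b \<in> B i \<inter> B j" using y b by auto
          then show False using disj[of i j] i j by auto
        qed
        then show "k \<in> c ` (U - D)" using b i U by auto
      qed
      have "c ` U \<subseteq> c ` (U - D)"
      proof
        fix k assume "k \<in> c ` U"
        then obtain u where u: "u \<in> U" "k = c u" by auto
        show "k \<in> c ` (U - D)"
        proof (cases "u \<in> D")
          case True
          then have "k \<in> c ` B i" using u y a by (auto simp: D_def)
          then show ?thesis using Bi by auto
        qed (use u in auto)
      qed
      then have "card (c ` U) \<le> card (U - D)"
        using finU by (meson card_image_le card_mono finite_Diff finite_imageI le_trans)
      also have "\<dots> = card U - t" using DU \<open>card D = t\<close> finU by (simp add: card_Diff_subset finite_subset)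
      finally show False using excess card_mono[OF finU DU] \<open>card D = t\<close> by linarith
    qed
    then obtain j where j: "j < t" "j \<noteq> i" "c ` B i \<inter> c ` B j = {}" by blast
    have aj: "a \<notin> B j" using j a by auto
    obtain y where y: "y \<in> B j - B i" "is_base (insert y (B i - {a}))" "is_base (insert a (B j - {y}))"
      using symmetric_exchange[OF base[OF i] base[OF j(1)] a(1) aj] by blast
    define B' where "B' = B(i := insert y (B i - {a}), j := insert a (B j - {y}))"
    have base': "is_base (B' k)" if "k < t" for k
      using that base y by (auto simp: B'_def)
    have U': "(\<Union>k<t. B' k) = U"
    proof -
      have "(\<Union>k<t. B' k) = B' i \<union> B' j \<union> (\<Union>k\<in>{..<t} - {i,j}. B' k)" using i j by auto
      also have "(\<Union>k\<in>{..<t} - {i,j}. B' k) = (\<Union>k\<in>{..<t} - {i,j}. B k)" by (auto simp: B'_def)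
      also have "B' i \<union> B' j = B i \<union> B j" using y a j by (auto simp: B'_def)
      also have "B i \<union> B j \<union> (\<Union>k\<in>{..<t} - {i,j}. B k) = U" using i j U by auto
      finally show ?thesis .
    qed
    have disj': "B' k \<inter> B' l = {}" if kl: "k < t" "l < t" "k \<noteq> l" for k l
    proof -
      have d: "x \<notin> B m" if "x \<in> B l" "l < t" "m < t" "l \<noteq> m" for x l m
        using disj[of l m] that by auto
      have "a \<notin> B m" if "m < t" "m \<noteq> i" for m using d a i that by blast
      moreover have "y \<notin> B m" if "m < t" "m \<noteq> j" for m using d y j that by blast
      ultimately show ?thesis using disj[OF kl] kl a y d[of _ i j] i j
        by (auto simp: B'_def dest: d)
    qed
    have ci: "card (B' i) - card (c ` B' i) < card (B i) - card (c ` B i)"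
    proof -
      have "c ` B i = c ` (B i - {a})"
      proof
        show "c ` B i \<subseteq> c ` (B i - {a})" using a by (metis (no_types, lifting) Diff_iff image_eqI image_subsetI singletonD)
      qed auto
      moreover have "c y \<notin> c ` B i" using y j by auto
      ultimately have 1: "card (c ` B' i) = Suc (card (c ` B i))"
        using finB[OF i] j by (simp add: B'_def)
      have 2: "card (B' i) = card (B i)"
        using base' base i by (simp add: is_base_def)
      have "card (c ` B' i) \<le> card (B' i)"
        using base_finite[OF base'[OF i]] by (rule card_image_le)
      then show ?thesis using 1 2 by linarith
    qed
    \<comment> \<open>Giving up \<open>y\<close> costs at most one colour; \<open>a\<close> brings
      one back, since its colour occurs in \<open>B i\<close> and therefore not in
      \<open>B j\<close>.\<close>
    have cj: "card (B' j) - card (c ` B' j) \<le> card (B j) - card (c ` B j)"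
    proof -
      have "c a \<notin> c ` B j" using a j by auto
      then have "card (c ` B' j) = Suc (card (c ` (B j - {y})))"
        using finB[OF j(1)] by (simp add: B'_def) (metis card_insert_disjoint finite_Diff finite_imageI Diff_subset image_mono subsetD)
      moreover have "card (c ` B j) \<le> Suc (card (c ` (B j - {y})))"
      proof -
        have "c ` B j \<subseteq> insert (c y) (c ` (B j - {y}))" by auto
        then have "card (c ` B j) \<le> card (insert (c y) (c ` (B j - {y})))"
          using finB[OF j(1)] by (intro card_mono) auto
        also have "\<dots> \<le> Suc (card (c ` (B j - {y})))"
          using finB[OF j(1)] by (simp add: card_insert_if)
        finally show ?thesis .
      qed
      moreover have "card (B' j) = card (B j)"
        using base' base j by (simp add: is_base_def)
      ultimately show ?thesis by linarith
    qed
    have "(\<Sum>k<t. card (B' k) - card (c ` B' k)) < (\<Sum>k<t. card (B k) - card (c ` B k))"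
    proof (rule sum_strict_mono_ex1)
      show "\<forall>k\<in>{..<t}. card (B' k) - card (c ` B' k) \<le> card (B k) - card (c ` B k)"
      proof
        fix k assume "k \<in> {..<t}"
        show "card (B' k) - card (c ` B' k) \<le> card (B k) - card (c ` B k)"
        proof (cases "k = i \<or> k = j")
          case True
          then show ?thesis using ci cj by auto
        qed (simp add: B'_def)
      qed
      show "\<exists>k\<in>{..<t}. card (B' k) - card (c ` B' k) < card (B k) - card (c ` B k)"
        using ci i by blast
    qed simp
    then show ?thesis using less.hyps[of B'] base' disj' U' by blast
  qed
qed

section \<open>Packing bases and rainbow sparse sets\<close>

text \<open>Matroid union by way of Rado: each element of \<open>U\<close> selects one of
  \<open>t\<close> copies of the matroid, and sparseness of \<open>U\<close> is exactly the rank
  condition. Counting then forces every part to be a base.\<close>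

lemma partition_into_bases:
  assumes U: "U \<subseteq> E" "sparse (\<lambda>X. t * r X) U" "card U = t * r E"
  shows "\<exists>B :: nat \<Rightarrow> 'e set. (\<forall>i<t. is_base (B i)) \<and>
     (\<forall>i<t. \<forall>j<t. i \<noteq> j \<longrightarrow> B i \<inter> B j = {}) \<and> (\<Union>i<t. B i) = U"
proof (cases "t = 0")
  case True
  then show ?thesis using U finite_subset[OF U(1) finite_E] by auto
next
  case False
  have finU: "finite U" using finite_subset[OF U(1) finite_E] .
  \<comment> \<open>The rank of the direct sum of \<open>t\<close> copies of the matroid: the pair
    \<open>(e, i)\<close> is the element \<open>e\<close> in copy \<open>i\<close>.\<close>
  define g where "g Z = (\<Sum>i<t. r {e. (e, i) \<in> Z})" for Z :: "('e \<times> nat) set"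
  have "\<exists>a. (\<forall>e\<in>U. a e \<in> {e} \<times> {..<t}) \<and> (\<forall>J\<subseteq>U. card J \<le> g (a ` J))"
  proof (rule rado_selection)
    show "g X \<le> g Y" if "X \<subseteq> Y" for X Y
      unfolding g_def using that by (intro sum_mono r_mono) auto
    show "g (X \<union> Y) + g (X \<inter> Y) \<le> g X + g Y" for X Y
    proof -
      have "r {e. (e, i) \<in> X \<union> Y} + r {e. (e, i) \<in> X \<inter> Y} \<le> r {e. (e, i) \<in> X} + r {e. (e, i) \<in> Y}" for i
        using r_submodular[of "{e. (e, i) \<in> X}" "{e. (e, i) \<in> Y}"]
        by (simp add: Collect_disj_eq Collect_conj_eq)
      then show ?thesis unfolding g_def sum.distrib[symmetric] by (intro sum_mono) auto
    qed
    show "finite U" by fact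
    show "finite ({e} \<times> {..<t}) \<and> {e} \<times> {..<t} \<noteq> {}" for e :: 'e using False by auto
    show "card J \<le> g (\<Union>e\<in>J. {e} \<times> {..<t})" if "J \<subseteq> U" for J
    proof -
      have "{e. (e, i) \<in> (\<Union>e\<in>J. {e} \<times> {..<t})} = J" if "i < t" for i using that by auto
      then have "g (\<Union>e\<in>J. {e} \<times> {..<t}) = t * r J" by (simp add: g_def)
      then show ?thesis using U that by (simp add: sparse_def)
    qed
  qed
  then obtain a where a: "\<And>e. e \<in> U \<Longrightarrow> a e \<in> {e} \<times> {..<t}" and card: "card U \<le> g (a ` U)" by blast
  define B where "B i = {e \<in> U. snd (a e) = i}" for i
  have finB: "finite (B i)" for i using finU by (simp add: B_def)
  have UB: "(\<Union>i<t. B i) = U" using a by (fastforce simp: B_def)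
  have disj: "B i \<inter> B j = {}" if "i \<noteq> j" for i j using that by (auto simp: B_def)
  have slice: "{e. (e, i) \<in> a ` U} = B i" for i
  proof -
    have "(e, i) \<in> a ` U \<longleftrightarrow> e \<in> B i" for e
    proof
      assume "(e, i) \<in> a ` U"
      then obtain x where "x \<in> U" "a x = (e, i)" by auto
      then show "e \<in> B i" using a[of x] by (auto simp: B_def)
    next
      assume "e \<in> B i"
      then have "e \<in> U" "a e = (e, i)" using a[of e] by (auto simp: B_def)
      then show "(e, i) \<in> a ` U" by force
    qed
    then show ?thesis by auto
  qed
  have BE: "B i \<subseteq> E" for i using U by (auto simp: B_def)
  \<comment> \<open>The ranks of the parts sum to at least \<open>card U = t * r E\<close>, while
    each is at most \<open>r E\<close>. So all are equal to \<open>r E\<close>, and since the sizes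
    sum to the same number, they are too.\<close>
  have le: "(\<Sum>i<t. r E) \<le> (\<Sum>i<t. r (B i))" using card U(3) slice by (simp add: g_def)
  have sumcard: "(\<Sum>i<t. card (B i)) = card U"
    using card_UN_disjoint[of "{..<t}" B] finB disj UB by auto
  have rB: "r (B i) = r E" if "i < t" for i
  proof (rule ccontr)
    assume "r (B i) \<noteq> r E"
    then have "r (B i) < r E" using r_le_rank[OF BE, of i] by auto
    then have "(\<Sum>i<t. r (B i)) < (\<Sum>i<t. r E)"
      using that r_le_rank[OF BE] by (intro sum_strict_mono_ex1) auto
    then show False using le by simp
  qed
  have cB: "card (B i) = r E" if "i < t" for i
  proof (rule ccontr)
    assume "card (B i) \<noteq> r E"
    then have "r E < card (B i)" using rB[OF that] r_le_card[OF finB, of i] by auto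
    moreover have "r E \<le> card (B j)" if "j < t" for j using rB[OF that] r_le_card[OF finB, of j] by auto
    ultimately have "(\<Sum>i<t. r E) < (\<Sum>i<t. card (B i))"
      using that by (intro sum_strict_mono_ex1) auto
    then show False using sumcard U(3) by simp
  qed
  show ?thesis using rB cB BE disj UB by (intro exI[of _ B]) (auto simp: is_base_def)
qed

text \<open>Rado's theorem with defect \<open>d\<close>: applied to the colour classes and
  \<open>t * r + d\<close>, it selects one element of every colour, a set that may violate
  sparseness by up to \<open>d\<close>. A largest sparse subset then loses at most \<open>d\<close>
  of the elements, which leaves \<open>q\<close>.\<close>

lemma rainbow_sparse_set:
  fixes c :: "'e \<Rightarrow> 'c"
  assumes q: "\<And>X. X \<subseteq> E \<Longrightarrow> q \<le> t * r X + card (c ` (E - X))"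
  shows "\<exists>R. R \<subseteq> E \<and> inj_on c R \<and> sparse (\<lambda>X. t * r X) R \<and> q \<le> card R"
proof -
  let ?K = "c ` E" and ?f = "\<lambda>X. t * r X"
  have finK: "finite ?K" using finite_E by simp
  define d where "d = card ?K - q"
  have qK: "q \<le> card ?K" using q[of "{}"] r_empty by simp
  have f_mono: "?f X \<le> ?f Y" if "X \<subseteq> Y" for X Y using r_mono[OF that] by simp
  have f_submod: "?f (X \<union> Y) + ?f (X \<inter> Y) \<le> ?f X + ?f Y" for X Y
    using mult_le_mono2[OF r_submodular[of X Y], of t] by (simp add: distrib_left)
  define A where "A k = {e \<in> E. c e = k}" for k
  have "\<exists>a. (\<forall>k\<in>?K. a k \<in> A k) \<and> (\<forall>J\<subseteq>?K. card J \<le> ?f (a ` J) + d)"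
  proof (rule rado_selection)
    show "?f X + d \<le> ?f Y + d" if "X \<subseteq> Y" for X Y using f_mono[OF that] by simp
    show "(?f (X \<union> Y) + d) + (?f (X \<inter> Y) + d) \<le> (?f X + d) + (?f Y + d)" for X Y
      using f_submod[of X Y] by simp
    show "finite ?K" by fact
    show "finite (A k) \<and> A k \<noteq> {}" if "k \<in> ?K" for k using that finite_E by (auto simp: A_def)
    \<comment> \<open>On a union of whole colour classes, the colours outside are exactly those of
      \<open>?K - J\<close>, so the hypothesis becomes the rank condition with defect.\<close>
    show "card J \<le> ?f (\<Union> (A ` J)) + d" if J: "J \<subseteq> ?K" for J
    proof -
      have "c ` (E - \<Union> (A ` J)) = ?K - J" by (auto simp: A_def)
      moreover have "card (?K - J) = card ?K - card J"
        using J finK by (simp add: card_Diff_subset finite_subset)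
      moreover have "\<Union> (A ` J) \<subseteq> E" by (auto simp: A_def)
      ultimately have "q \<le> ?f (\<Union> (A ` J)) + (card ?K - card J)" using q by metis
      then show ?thesis using qK card_mono[OF finK J] by (simp add: d_def)
    qed
  qed
  then obtain a where a: "\<And>k. k \<in> ?K \<Longrightarrow> a k \<in> A k" and ar: "\<And>J. J \<subseteq> ?K \<Longrightarrow> card J \<le> ?f (a ` J) + d"
    by blast
  let ?R = "a ` ?K"
  have ca: "c (a k) = k" if "k \<in> ?K" for k using a[OF that] by (simp add: A_def)
  have inja: "inj_on a ?K" using ca by (metis inj_onI)
  have injc: "inj_on c ?R" using ca by (auto simp: inj_on_def)
  have RE: "?R \<subseteq> E" using a by (auto simp: A_def)
  have "sparse ?f {}" by (simp add: sparse_def)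
  then obtain I X where I: "I \<subseteq> ?R" "sparse ?f I" and X: "X \<subseteq> ?R" "?f X + card (?R - X) \<le> card I"
    using sparse_extension[of ?f ?R "{}"] f_mono f_submod r_empty finK by auto
  obtain J where J: "J \<subseteq> ?K" "X = a ` J" using X(1) by (meson subset_imageE)
  have "card X \<le> ?f X + d"
    using ar[OF J(1)] J card_image_le[of J a] finite_subset[OF J(1) finK] by auto
  moreover have "card (?R - X) = card ?R - card X"
    using X(1) finK by (simp add: card_Diff_subset finite_subset)
  moreover have "card ?R = card ?K" using inja by (rule card_image)
  ultimately have "card ?K \<le> card I + d" using X(2) by linarith
  then have "q \<le> card I" using qK by (simp add: d_def)
  then show ?thesis using I RE injc by (meson inj_on_subset subset_trans)
qed

lemma has_rainbow_bases_if_many_colours: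
  fixes c :: "'e \<Rightarrow> 'c"
  assumes t: "t \<ge> 1"
    and pack: "\<And>F. F \<subseteq> E \<Longrightarrow> t * (r E - r F) \<le> card E - card F"
    and many: "\<And>F. F \<subseteq> E \<Longrightarrow> r E - r F \<ge> 2 \<Longrightarrow> card F + t * (r E - r F - 1) < card (c ` E)"
  shows "has_rainbow_bases c t"
proof -
  let ?f = "\<lambda>X. t * r X"
  have f_mono: "?f X \<le> ?f Y" if "X \<subseteq> Y" for X Y using r_mono[OF that] by simp
  have f_submod: "?f (X \<union> Y) + ?f (X \<inter> Y) \<le> ?f X + ?f Y" for X Y
    using mult_le_mono2[OF r_submodular[of X Y], of t] by (simp add: distrib_left)
  have "t * r E + 1 - t \<le> ?f X + card (c ` (E - X))" if X: "X \<subseteq> E" for X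
  proof -
    have fX: "finite X" using finite_subset[OF X finite_E] .
    have "\<exists>s. r E = r X + s" using r_le_rank[OF X] le_Suc_ex by blast
    then obtain s where s: "r E = r X + s" by blast
    \<comment> \<open>What is needed is \<open>t * (s - 1) + 1\<close> colours outside
      \<open>X\<close> if \<open>s \<ge> 1\<close>, and none if \<open>s = 0\<close>. For
      \<open>s = 1\<close> a nonempty complement is enough.\<close>
    consider "s = 0" | "s = 1" | "s \<ge> 2" by linarith
    then show ?thesis
    proof cases
      case 1
      then show ?thesis using s t by simp
    next
      case 2
      have "t \<le> card E - card X" using pack[OF X] s 2 by simp
      then have "E - X \<noteq> {}" using t X fX by (auto simp: card_Diff_subset[symmetric])
      then have "card (c ` (E - X)) \<ge> 1" using finite_E by (simp add: Suc_le_eq card_gt_0_iff)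
      then show ?thesis using s 2 by (simp add: distrib_left)
    next
      case 3
      have "c ` E = c ` X \<union> c ` (E - X)" using X by auto
      then have "card (c ` E) \<le> card (c ` X) + card (c ` (E - X))" by (metis card_Un_le)
      also have "\<dots> \<le> card X + card (c ` (E - X))" using card_image_le[OF fX] by simp
      finally have "t * (s - 1) + 1 \<le> card (c ` (E - X))" using many[OF X] s 3 by simp
      moreover obtain s' where "s = Suc s'" using 3 by (cases s) auto
      ultimately show ?thesis using s by (simp add: algebra_simps)
    qed
  qed
  from rainbow_sparse_set[of "t * r E + 1 - t" t c, OF this]
  obtain R where R: "R \<subseteq> E" "inj_on c R" "sparse ?f R" "t * r E + 1 - t \<le> card R" by blast
  obtain U X where U: "R \<subseteq> U" "U \<subseteq> E" "sparse ?f U" and X: "X \<subseteq> E" "?f X + card (E - X) \<le> card U"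
    using sparse_extension[of ?f E R] f_mono f_submod r_empty finite_E R by auto
  have finU: "finite U" using finite_subset[OF U(2) finite_E] .
  \<comment> \<open>The packing condition makes the certificate of maximality at least
    \<open>t * r E\<close>, and sparseness of \<open>U\<close> bounds its size by the same
    number.\<close>
  have "t * r E \<le> ?f X + card (E - X)"
  proof -
    have "t * (r E - r X) \<le> card (E - X)"
      using pack[OF X(1)] X(1) finite_E by (simp add: card_Diff_subset finite_subset)
    moreover have "t * r E = t * r X + t * (r E - r X)"
      using r_le_rank[OF X(1)] by (simp flip: distrib_left)
    ultimately show ?thesis by simp
  qed
  moreover have "card U \<le> t * r E"
    using U f_mono[OF U(2)] by (meson order_refl order_trans sparse_def)
  ultimately have cU: "card U = t * r E" using X(2) by simp
  obtain B :: "nat \<Rightarrow> 'e set" where B: "\<forall>i<t. is_base (B i)"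
     "\<forall>i<t. \<forall>j<t. i \<noteq> j \<longrightarrow> B i \<inter> B j = {}" "(\<Union>i<t. B i) = U"
    using partition_into_bases[OF U(2,3) cU] by blast
  have "card R = card (c ` R)" using R(2) by (simp add: card_image)
  also have "\<dots> \<le> card (c ` U)" using U finU by (intro card_mono) auto
  finally have "card U < card (c ` U) + t" using cU R(4) t by linarith
  then show ?thesis using rainbow_bases_of_partition[of t B U c] B by blast
qed

section \<open>Colourings without disjoint rainbow bases\<close>

lemma no_disjoint_bases:
  assumes F: "F \<subseteq> E" "card E - card F < t * (r E - r F)"
  shows "\<not> has_rainbow_bases c t"
proof
  assume "has_rainbow_bases c t"
  then obtain B :: "nat \<Rightarrow> 'e set" where "\<forall>i<t. is_base (B i) \<and> inj_on c (B i)"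
    and disj: "\<forall>i<t. \<forall>j<t. i \<noteq> j \<longrightarrow> B i \<inter> B j = {}"
    unfolding has_rainbow_bases_def by metis
  then have base: "is_base (B i)" if "i < t" for i using that by simp
  have "t * (r E - r F) = (\<Sum>i<t. r E - r F)" by simp
  also have "\<dots> \<le> (\<Sum>i<t. card (B i - F))"
    using card_base_Diff[OF base F(1)] by (intro sum_mono) auto
  also have "\<dots> = card (\<Union>i<t. B i - F)"
  proof (rule card_UN_disjoint[symmetric])
    show "\<forall>i\<in>{..<t}. finite (B i - F)" using base base_finite by auto
    show "\<forall>i\<in>{..<t}. \<forall>j\<in>{..<t}. i \<noteq> j \<longrightarrow> (B i - F) \<inter> (B j - F) = {}" using disj by blast
  qed simp
  also have "\<dots> \<le> card (E - F)"
    using base finite_E by (intro card_mono) (auto simp: is_base_def)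
  also have "\<dots> = card E - card F" using F finite_E by (simp add: card_Diff_subset finite_subset)
  finally show False using F by simp
qed

text \<open>
  The colouring: \<open>F\<close> and \<open>t (r E - r F - 1) - 1\<close> further elements are coloured injectively and
  the rest gets one additional colour.
\<close>

lemma colouring_without_rainbow_bases:
  assumes t: "t \<ge> 1" and F: "F \<subseteq> E" "r E - r F \<ge> 2"
    and pack: "t * (r E - r F) \<le> card E - card F"
  shows "\<exists>c :: 'e \<Rightarrow> nat. card (c ` E) = card F + t * (r E - r F - 1) \<and> \<not> has_rainbow_bases c t"
proof -
  define s where "s = r E - r F"
  have s: "s \<ge> 2" "t * s \<le> card (E - F)"
    using F pack finite_E by (auto simp: s_def card_Diff_subset finite_subset)
  have ts: "t * (s - 1) < t * s" "t * (s - 1) \<ge> 1" using t s by auto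
  obtain D where D: "D \<subseteq> E - F" "card D = t * (s - 1) - 1"
    using obtain_subset_with_card_n[of "t * (s - 1) - 1" "E - F"] ts s by (metis diff_le_self le_trans less_imp_le)
  have fin: "finite F" "finite D" using F D finite_E by (auto intro: finite_subset)
  obtain h :: "'e \<Rightarrow> nat" where h: "inj_on h E" using finite_E finite_imp_inj_to_nat_seg by metis
  define c where "c e = (if e \<in> F \<union> D then Suc (h e) else 0)" for e
  let ?Z = "E - (F \<union> D)"
  \<comment> \<open>Some element must remain outside \<open>F \<union> D\<close>: colour 0 is then
    really used, and it makes up for the \<open>- 1\<close> in the size of \<open>D\<close>.\<close>
  have "card D < card (E - F)" using D s ts by linarith
  then have "?Z \<noteq> {}" using D fin card_mono[of D "E - F"] by (metis Diff_eq_empty_iff Diff_subset_conv not_le)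
  then have img: "c ` E = insert 0 ((\<lambda>e. Suc (h e)) ` (F \<union> D))"
    using F D by (fastforce simp: c_def)
  have "card ((\<lambda>e. Suc (h e)) ` (F \<union> D)) = card (F \<union> D)"
    using h F D by (intro card_image) (auto simp: inj_on_def)
  also have "\<dots> = card F + card D" using D fin by (intro card_Un_disjoint) auto
  finally have "card (c ` E) = Suc (card F + card D)"
    using img fin by (simp add: card_insert_if image_iff)
  then have "card (c ` E) = card F + t * (s - 1)" using D(2) ts(2) by linarith
  moreover have "\<not> has_rainbow_bases c t"
  proof
    assume "has_rainbow_bases c t"
    then obtain B :: "nat \<Rightarrow> 'e set" where B: "\<And>i. i < t \<Longrightarrow> is_base (B i) \<and> inj_on c (B i)"
       "\<And>i j. i < t \<Longrightarrow> j < t \<Longrightarrow> i \<noteq> j \<Longrightarrow> B i \<inter> B j = {}"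
      unfolding has_rainbow_bases_def by blast
    \<comment> \<open>A base has at least \<open>s\<close> elements outside \<open>F\<close>, and a
      rainbow one has at most one of colour 0. So \<open>t\<close> disjoint rainbow bases would need
      \<open>t * (s - 1)\<close> elements of \<open>D\<close>, one more than there are.\<close>
    have each: "s - 1 \<le> card (B i \<inter> D)" if i: "i < t" for i
    proof -
      have fB: "finite (B i)" using B i base_finite by blast
      have "s \<le> card (B i - F)" using card_base_Diff[OF _ F(1)] B i by (auto simp: s_def)
      also have "B i - F = (B i \<inter> D) \<union> (B i - (F \<union> D))" using D by auto
      also have "card \<dots> \<le> card (B i \<inter> D) + card (B i - (F \<union> D))" by (rule card_Un_le)
      also have "card (B i - (F \<union> D)) \<le> 1"
      proof -
        have "x = y" if "x \<in> B i - (F \<union> D)" "y \<in> B i - (F \<union> D)" for x y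
          using B(1)[OF i] that by (auto simp: inj_on_def c_def)
        then show ?thesis using fB by (metis card_le_Suc0_iff_eq finite_Diff One_nat_def)
      qed
      finally show ?thesis by simp
    qed
    have "t * (s - 1) = (\<Sum>i<t. s - 1)" by simp
    also have "\<dots> \<le> (\<Sum>i<t. card (B i \<inter> D))" using each by (intro sum_mono) auto
    also have "\<dots> = card (\<Union>i<t. B i \<inter> D)"
    proof (rule card_UN_disjoint[symmetric])
      show "\<forall>i\<in>{..<t}. \<forall>j\<in>{..<t}. i \<noteq> j \<longrightarrow> (B i \<inter> D) \<inter> (B j \<inter> D) = {}" using B(2) by fastforce
    qed (use fin in auto)
    also have "\<dots> \<le> card D" using fin by (intro card_mono) auto
    finally show False using D ts by linarith
  qed
  ultimately show ?thesis unfolding s_def by blast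
qed

end

text \<open>\<open>cl F\<close> collects the elements without gain over \<open>F\<close>; its
  monotonicity says that unit gains diminish. Adding a set element by element turns this into
  submodularity, so for the bicircular rank it suffices to know the effect of a single edge.\<close>

lemma matroid_rank_from_gains:
  fixes r :: "'e set \<Rightarrow> nat"
  assumes fin: "finite E" and empty: "r {} = 0" and restrict: "\<And>X. r (X \<inter> E) = r X"
    and insert: "\<And>F e. F \<subseteq> E \<Longrightarrow> e \<in> E \<Longrightarrow> r (insert e F) = r F + (if e \<in> cl F then 0 else 1)"
    and cl_mono: "\<And>F F'. F \<subseteq> F' \<Longrightarrow> cl F \<subseteq> cl F'"
  shows "matroid_rank E r"
proof
  \<comment> \<open>With \<open>X \<inter> Y\<close> for \<open>Z\<close> and \<open>Y\<close> for
    \<open>D\<close>, the first conjunct is submodularity; the others give monotonicity and the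
    bound by cardinality.\<close>
  have step: "r (X \<union> D) + r Z \<le> r X + r (Z \<union> D) \<and> r X \<le> r (X \<union> D) \<and> r D \<le> card D"
    if "D \<subseteq> E" "X \<subseteq> E" "Z \<subseteq> X" for X Z D
  proof -
    have "finite D" using that(1) fin finite_subset by blast
    then show ?thesis using that(1)
    proof (induction D rule: finite_induct)
      case (insert e D)
      then have "e \<in> E" "D \<subseteq> E" by auto
      then have "r (insert e (X \<union> D)) = r (X \<union> D) + (if e \<in> cl (X \<union> D) then 0 else 1)"
        "r (insert e (Z \<union> D)) = r (Z \<union> D) + (if e \<in> cl (Z \<union> D) then 0 else 1)"
        "r (insert e D) \<le> r D + 1"
        using assms(4)[of _ e] that by auto
      moreover have "cl (Z \<union> D) \<subseteq> cl (X \<union> D)" using that by (intro cl_mono) auto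
      ultimately show ?case using insert.IH[OF \<open>D \<subseteq> E\<close>] insert.hyps by auto
    qed (simp add: empty)
  qed
  show "finite E" by fact
  show "r X \<le> r Y" if "X \<subseteq> Y" for X Y
  proof -
    have "X \<inter> E \<union> Y \<inter> E = Y \<inter> E" using that by auto
    then show ?thesis using step[of "Y \<inter> E" "X \<inter> E" "{}"] restrict by simp
  qed
  show "r (X \<union> Y) + r (X \<inter> Y) \<le> r X + r Y" for X Y
  proof -
    have "X \<inter> Y \<inter> E \<union> Y \<inter> E = Y \<inter> E" "X \<inter> E \<union> Y \<inter> E = (X \<union> Y) \<inter> E" by auto
    then show ?thesis
      using step[of "Y \<inter> E" "X \<inter> E" "X \<inter> Y \<inter> E"] restrict by (metis inf.cobounded2 inf_assoc inf_commute inf_left_commute inf_le1)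
  qed
  show "r X \<le> card X" if "finite X" for X
  proof -
    have "r X \<le> card (X \<inter> E)" using step[of "X \<inter> E" "{}" "{}"] restrict by simp
    also have "\<dots> \<le> card X" using that by (intro card_mono) auto
    finally show ?thesis .
  qed
qed

section \<open>The bicircular matroid\<close>

text \<open>If the next vertex has been visited before, the path is cut back to that visit, which
  preserves distinctness.\<close>

lemma rtrancl_distinct_path:
  assumes "(u, v) \<in> A\<^sup>*"
  shows "\<exists>vs. vs \<noteq> [] \<and> hd vs = u \<and> last vs = v \<and> distinct vs \<and>
    (\<forall>i. Suc i < length vs \<longrightarrow> (vs ! i, vs ! Suc i) \<in> A)"
  using assms
proof (induction rule: rtrancl_induct)
  case base
  then show ?case by (intro exI[of _ "[u]"]) auto
next
  case (step v w)
  then obtain vs where vs: "vs \<noteq> []" "hd vs = u" "last vs = v" "distinct vs"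
    "\<And>i. Suc i < length vs \<Longrightarrow> (vs ! i, vs ! Suc i) \<in> A" by blast
  show ?case
  proof (cases "w \<in> set vs")
    case True
    then obtain k where k: "k < length vs" "vs ! k = w" by (auto simp: in_set_conv_nth)
    have "last (take (Suc k) vs) = w" using k by (simp add: take_Suc_conv_app_nth)
    moreover have "hd (take (Suc k) vs) = u" using vs by simp
    ultimately show ?thesis using vs k by (intro exI[of _ "take (Suc k) vs"]) auto
  next
    case False
    have "(((vs @ [w]) ! i), ((vs @ [w]) ! Suc i)) \<in> A" if i: "Suc i < length (vs @ [w])" for i
    proof (cases "Suc i < length vs")
      case True
      then show ?thesis using vs(5)[OF True] by (simp add: nth_append)
    next
      case False
      then have "i = length vs - 1" "Suc i = length vs" using i vs by auto
      then show ?thesis using vs step by (simp add: nth_append last_conv_nth)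
    qed
    then show ?thesis using False vs by (intro exI[of _ "vs @ [w]"]) auto
  qed
qed

locale fixed_multigraph =
  fixes G :: "('v, 'e) mgraph"
  assumes multigraph: "multigraph G"
begin

abbreviation V where "V \<equiv> mverts G"
abbreviation E where "E \<equiv> medges G"
abbreviation ends where "ends \<equiv> mends G"

section \<open>Connectivity and cycles as functions of the edge set\<close>

definition adj :: "'e set \<Rightarrow> ('v \<times> 'v) set" where
  "adj F = {(u, v). \<exists>e\<in>F. ends e = {u, v}}"

text \<open>The vertex set of the component of \<open>x\<close>. Having it depend on the edge set
  alone makes monotonicity and single-edge insertion easy to state, without subgraph
  records.\<close>

definition cls :: "'e set \<Rightarrow> 'v \<Rightarrow> 'v set" where
  "cls F x = (adj F)\<^sup>* `` {x}"

definition cycle_walk :: "'e set \<Rightarrow> 'v list \<Rightarrow> 'e list \<Rightarrow> bool" where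
  "cycle_walk F vs es \<longleftrightarrow> vs \<noteq> [] \<and> length es = length vs \<and> distinct vs \<and> distinct es \<and>
     set vs \<subseteq> V \<and> set es \<subseteq> F \<and>
     (\<forall>i<length vs. ends (es ! i) = {vs ! i, vs ! (Suc i mod length vs)})"

definition cycle_at :: "'e set \<Rightarrow> 'v \<Rightarrow> 'e set \<Rightarrow> bool" where
  "cycle_at F x C \<longleftrightarrow> (\<exists>vs es. cycle_walk F vs es \<and> set vs \<subseteq> cls F x \<and> C = set es)"

text \<open>For \<open>F \<subseteq> E\<close> this is the union of the components that are not
  trees. An edge outside \<open>F\<close> adds nothing to the bicircular rank of \<open>F\<close>
  exactly when both its ends lie here.\<close>

definition cyclic :: "'e set \<Rightarrow> 'v set" where
  "cyclic F = {x. \<exists>C. cycle_at F x C}"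

lemma finite_V: "finite V" and finite_E: "finite E"
  using multigraph by (auto simp: multigraph_def)

lemma ends_subset: "e \<in> E \<Longrightarrow> ends e \<subseteq> V"
  using multigraph by (auto simp: multigraph_def)

lemma ends_pair:
  assumes "e \<in> E"
  obtains u v where "ends e = {u, v}" "u \<in> V" "v \<in> V"
proof -
  have "card (ends e) = 1 \<or> card (ends e) = 2" using assms multigraph by (auto simp: multigraph_def)
  then have "\<exists>u v. ends e = {u, v}" by (metis card_1_singletonE card_2_iff insert_absorb2)
  then show ?thesis using that ends_subset[OF assms] by auto
qed

lemma sym_adj: "sym (adj F)"
  by (auto simp: sym_def adj_def insert_commute)

lemma conn_sym: "(x, y) \<in> (adj F)\<^sup>* \<Longrightarrow> (y, x) \<in> (adj F)\<^sup>*"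
  using sym_rtrancl[OF sym_adj] by (meson symD)

lemma adj_mono: "F \<subseteq> F' \<Longrightarrow> adj F \<subseteq> adj F'"
  by (auto simp: adj_def)

lemma conn_mono: "F \<subseteq> F' \<Longrightarrow> (adj F)\<^sup>* \<subseteq> (adj F')\<^sup>*"
  by (intro rtrancl_mono adj_mono)

lemma cls_mono: "F \<subseteq> F' \<Longrightarrow> cls F x \<subseteq> cls F' x"
  using conn_mono by (auto simp: cls_def)

lemma cls_self: "x \<in> cls F x"
  by (simp add: cls_def)

lemma cls_eq: "y \<in> cls F x \<Longrightarrow> cls F y = cls F x"
  unfolding cls_def using conn_sym[of x y F] rtrancl_trans[of _ _ "adj F"] by blast

lemma cls_eq_iff: "cls F x = cls F y \<longleftrightarrow> y \<in> cls F x"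
  using cls_eq cls_self by metis

lemma cls_image_cls: "cls F ` cls F x = {cls F x}"
proof
  show "cls F ` cls F x \<subseteq> {cls F x}" using cls_eq[of _ F x] by blast
  show "{cls F x} \<subseteq> cls F ` cls F x" using cls_self by blast
qed

lemma cls_subset_V: "F \<subseteq> E \<Longrightarrow> x \<in> V \<Longrightarrow> cls F x \<subseteq> V"
proof
  fix y assume F: "F \<subseteq> E" and x: "x \<in> V" and "y \<in> cls F x"
  then have "(x, y) \<in> (adj F)\<^sup>*" by (simp add: cls_def)
  then show "y \<in> V"
  proof (induction rule: rtrancl_induct)
    case (step y z)
    then show ?case using F ends_subset by (fastforce simp: adj_def)
  qed (use x in simp)
qed

lemma cls_empty: "cls {} x = {x}"
  by (auto simp: cls_def adj_def)

lemma cycle_walk_mono: "F \<subseteq> F' \<Longrightarrow> cycle_walk F vs es \<Longrightarrow> cycle_walk F' vs es"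
  by (auto simp: cycle_walk_def)

lemma cycle_at_mono: "F \<subseteq> F' \<Longrightarrow> cycle_at F x C \<Longrightarrow> cycle_at F' x C"
  unfolding cycle_at_def using cycle_walk_mono[of F F'] cls_mono[of F F' x] by blast

lemma cyclic_mono: "F \<subseteq> F' \<Longrightarrow> cyclic F \<subseteq> cyclic F'"
  using cycle_at_mono[of F F'] by (auto simp: cyclic_def)

lemma cycle_at_cls: "y \<in> cls F x \<Longrightarrow> cycle_at F y C \<longleftrightarrow> cycle_at F x C"
  using cls_eq by (simp add: cycle_at_def)

lemma cyclic_cls: "y \<in> cls F x \<Longrightarrow> y \<in> cyclic F \<longleftrightarrow> x \<in> cyclic F"
  unfolding cyclic_def using cycle_at_cls[of y F x] by blast

lemma cycle_walk_edge_bypass: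
  assumes "cycle_walk F vs es" "k < length vs"
  shows "(vs ! (Suc k mod length vs), vs ! k) \<in> (adj (F - {es ! k}))\<^sup>*"
proof -
  let ?n = "length vs" and ?A = "adj (F - {es ! k})"
  have w: "vs \<noteq> []" "length es = ?n" "distinct es" "set es \<subseteq> F"
    "\<And>i. i < ?n \<Longrightarrow> ends (es ! i) = {vs ! i, vs ! (Suc i mod ?n)}"
    using assms by (auto simp: cycle_walk_def)
  \<comment> \<open>Going round the cycle from position \<open>k + 1\<close>, the first
    \<open>?n - 1\<close> steps avoid edge \<open>k\<close> and end at position
    \<open>k\<close>.\<close>
  have "(vs ! (Suc k mod ?n), vs ! ((Suc k + j) mod ?n)) \<in> ?A\<^sup>*" if "j < ?n" for j
    using that
  proof (induction j)
    case (Suc j)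
    let ?i = "(Suc k + j) mod ?n"
    have i: "?i < ?n" using w by simp
    have "?i \<noteq> k"
    proof (cases "Suc k + j < ?n")
      case False
      then have "?i = Suc k + j - ?n" using assms(2) Suc.prems by (simp add: mod_if)
      then show ?thesis using False Suc.prems assms(2) by linarith
    qed simp
    then have "es ! ?i \<in> F - {es ! k}"
      using w i assms(2) by (auto simp: nth_eq_iff_index_eq)
    then have "(vs ! ?i, vs ! (Suc ?i mod ?n)) \<in> ?A" using w(5)[OF i] by (auto simp: adj_def)
    moreover have "Suc ?i mod ?n = (Suc k + Suc j) mod ?n" by (simp add: mod_Suc_eq)
    ultimately show ?case using Suc by (simp add: rtrancl_into_rtrancl)
  qed simp
  moreover have "(Suc k + (?n - 1)) mod ?n = k"
  proof -
    have "Suc k + (?n - 1) = k + ?n" using assms(2) by simp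
    then show ?thesis using assms(2) by simp
  qed
  ultimately show ?thesis using assms(2) by (metis diff_less length_greater_0_conv w(1) zero_less_one)
qed

lemma cycle_edge_bypass:
  assumes "cycle_at F x C" "e \<in> C" "ends e = {u, v}"
  shows "(u, v) \<in> (adj (F - {e}))\<^sup>*" "u \<in> cls F x"
proof -
  obtain vs es where w: "cycle_walk F vs es" "set vs \<subseteq> cls F x" "C = set es"
    using assms by (auto simp: cycle_at_def)
  obtain k where k: "k < length vs" "e = es ! k"
    using w assms by (auto simp: in_set_conv_nth cycle_walk_def)
  have e: "{u, v} = {vs ! k, vs ! (Suc k mod length vs)}" using w k assms(3) by (simp add: cycle_walk_def)
  have c: "(vs ! (Suc k mod length vs), vs ! k) \<in> (adj (F - {e}))\<^sup>*"
    using cycle_walk_edge_bypass[OF w(1) k(1)] k(2) by simp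
  show "(u, v) \<in> (adj (F - {e}))\<^sup>*"
    using e c conn_sym[OF c] by (auto simp: doubleton_eq_iff)
  have "Suc k mod length vs < length vs" using k by (intro mod_less_divisor) auto
  then show "u \<in> cls F x" using e w(2) k nth_mem by (fastforce simp: doubleton_eq_iff)
qed

lemma cycle_through_edge:
  assumes F: "F \<subseteq> E" and e: "e \<in> E" "e \<notin> F" "ends e = {u, v}" and conn: "(u, v) \<in> (adj F)\<^sup>*"
  shows "\<exists>C. cycle_at (insert e F) u C \<and> e \<in> C"
proof -
  obtain vs where vs: "vs \<noteq> []" "hd vs = u" "last vs = v" "distinct vs"
    "\<And>i. Suc i < length vs \<Longrightarrow> (vs ! i, vs ! Suc i) \<in> adj F"
    using rtrancl_distinct_path[OF conn] by blast
  let ?n = "length vs"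
  have uv: "u = vs ! 0" "v = vs ! (?n - 1)" using vs by (auto simp: hd_conv_nth last_conv_nth)
  have "\<forall>i. \<exists>f. Suc i < ?n \<longrightarrow> f \<in> F \<and> ends f = {vs ! i, vs ! Suc i}"
    using vs(5) by (auto simp: adj_def)
  then obtain f where f: "\<And>i. Suc i < ?n \<Longrightarrow> f i \<in> F \<and> ends (f i) = {vs ! i, vs ! Suc i}" by metis
  \<comment> \<open>A simple path closed by \<open>e\<close>, which is put last so that its index
    wraps round to \<open>u\<close>. A loop gives the path of one vertex, and an edge parallel to
    one of \<open>F\<close> may give a cycle of length two, distinct because \<open>e\<close> is not
    in \<open>F\<close>.\<close>
  define es where "es = map f [0..<?n - 1] @ [e]"
  have len: "length es = ?n" using vs by (simp add: es_def)
  have inj: "inj_on f {0..<?n - 1}"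
  proof (rule inj_onI)
    fix i j assume ij: "i \<in> {0..<?n - 1}" "j \<in> {0..<?n - 1}" "f i = f j"
    then have "{vs ! i, vs ! Suc i} = {vs ! j, vs ! Suc j}" using f[of i] f[of j] by auto
    moreover have "Suc i < ?n" "Suc j < ?n" using ij by auto
    ultimately show "i = j" using vs(4) by (auto simp: doubleton_eq_iff nth_eq_iff_index_eq)
  qed
  have "f i \<in> F" if "i < ?n - 1" for i using f[of i] that by simp
  then have es: "distinct es" "set es \<subseteq> insert e F" using inj e by (auto simp: es_def distinct_map)
  have "ends (es ! i) = {vs ! i, vs ! (Suc i mod ?n)}" if i: "i < ?n" for i
  proof (cases "Suc i < ?n")
    case True
    moreover have "i < ?n - 1" using True by simp
    ultimately show ?thesis using f[OF True] by (simp add: es_def nth_append)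
  next
    case False
    then have "i = ?n - 1" "Suc i = ?n" using i by auto
    then show ?thesis using uv e vs by (auto simp: es_def nth_append)
  qed
  moreover have cls: "set vs \<subseteq> cls F u"
  proof
    have "vs ! i \<in> cls F u" if "i < ?n" for i
      using that
    proof (induction i)
      case 0
      then show ?case using uv cls_self by simp
    next
      case (Suc i)
      then have "(u, vs ! i) \<in> (adj F)\<^sup>*" by (simp add: cls_def)
      then show ?case using vs(5)[OF Suc.prems] by (simp add: cls_def rtrancl_into_rtrancl)
    qed
    then show "x \<in> cls F u" if "x \<in> set vs" for x using that by (auto simp: in_set_conv_nth)
  qed
  moreover have "u \<in> V" using ends_subset[OF e(1)] e(3) by simp
  ultimately have "cycle_walk (insert e F) vs es"
    using vs(1,4) len es cls_subset_V[OF F, of u] unfolding cycle_walk_def by blast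
  moreover have "set vs \<subseteq> cls (insert e F) u" using cls cls_mono[of F "insert e F" u] by blast
  moreover have "e \<in> set es" by (simp add: es_def)
  ultimately show ?thesis unfolding cycle_at_def by blast
qed

lemma cycle_walk_connected:
  assumes w: "cycle_walk F vs es"
  shows "set vs \<subseteq> cls F (hd vs)"
proof
  have "vs ! i \<in> cls F (hd vs)" if "i < length vs" for i
    using that
  proof (induction i)
    case 0
    then show ?case using w cls_self by (simp add: cycle_walk_def hd_conv_nth)
  next
    case (Suc i)
    then have "ends (es ! i) = {vs ! i, vs ! Suc i}" "es ! i \<in> F"
      using w by (auto simp: cycle_walk_def)
    then have "(vs ! i, vs ! Suc i) \<in> adj F" by (auto simp: adj_def)
    then show ?case using Suc by (simp add: cls_def rtrancl_into_rtrancl)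
  qed
  then show "x \<in> cls F (hd vs)" if "x \<in> set vs" for x
    using that by (auto simp: in_set_conv_nth)
qed

section \<open>Components and trees in terms of classes\<close>

lemma reachable_spanning:
  assumes "F \<subseteq> E" "x \<in> V"
  shows "reachable (spanning_subgraph G F) `` {x} = cls F x"
  using cls_subset_V[OF assms] assms(2)
  by (auto simp: reachable_def spanning_subgraph_def cls_def adj_def)

lemma components_spanning:
  assumes "F \<subseteq> E"
  shows "components (spanning_subgraph G F) =
    (\<lambda>x. induced_subgraph (spanning_subgraph G F) (cls F x)) ` V"
proof -
  have "V // reachable (spanning_subgraph G F) = cls F ` V"
    using reachable_spanning[OF assms] by (auto simp: quotient_def)
  moreover have "mverts (spanning_subgraph G F) = V" by (simp add: spanning_subgraph_def)
  ultimately show ?thesis by (simp add: components_def image_image)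
qed

lemma is_cycle_component:
  assumes "F \<subseteq> E" "x \<in> V"
  shows "is_cycle (induced_subgraph (spanning_subgraph G F) (cls F x)) C \<longleftrightarrow> cycle_at F x C"
proof
  assume "is_cycle (induced_subgraph (spanning_subgraph G F) (cls F x)) C"
  then obtain vs es where "vs \<noteq> []" "length es = length vs" "distinct vs" "distinct es"
    "set vs \<subseteq> cls F x" "set es \<subseteq> F" "C = set es"
    "\<forall>i<length vs. ends (es ! i) = {vs ! i, vs ! (Suc i mod length vs)}"
    unfolding is_cycle_def by (auto simp: induced_subgraph_def spanning_subgraph_def)
  then show "cycle_at F x C"
    using cls_subset_V[OF assms] unfolding cycle_at_def cycle_walk_def by blast
next
  assume "cycle_at F x C"
  then obtain vs es where w: "cycle_walk F vs es" "set vs \<subseteq> cls F x" "C = set es"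
    by (auto simp: cycle_at_def)
  have "ends e \<subseteq> cls F x" if "e \<in> set es" for e
  proof -
    have "length es = length vs" using w(1) by (simp add: cycle_walk_def)
    then obtain i where i: "i < length vs" "e = es ! i" using \<open>e \<in> set es\<close> by (metis in_set_conv_nth)
    moreover have "Suc i mod length vs < length vs" using i by (intro mod_less_divisor) auto
    ultimately show ?thesis using w nth_mem by (fastforce simp: cycle_walk_def)
  qed
  then show "is_cycle (induced_subgraph (spanning_subgraph G F) (cls F x)) C"
    using w unfolding is_cycle_def cycle_walk_def
    by (intro exI[of _ vs] exI[of _ es]) (auto simp: induced_subgraph_def spanning_subgraph_def)
qed

lemma mconnected_component: "mconnected (induced_subgraph (spanning_subgraph G F) (cls F x))"
proof -
  let ?D = "{e \<in> F. ends e \<subseteq> cls F x}"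
  have from_x: "(x, y) \<in> (adj ?D)\<^sup>*" if "y \<in> cls F x" for y
  proof -
    have "(x, y) \<in> (adj F)\<^sup>*" using that by (simp add: cls_def)
    then show ?thesis
    proof (induction rule: rtrancl_induct)
      case (step y z)
      then have "y \<in> cls F x" "z \<in> cls F x" by (auto simp: cls_def intro: rtrancl_into_rtrancl)
      then have "(y, z) \<in> adj ?D" using step.hyps(2) by (auto simp: adj_def)
      then show ?case using step.IH by (rule rtrancl_into_rtrancl[rotated])
    qed simp
  qed
  have "(u, v) \<in> (adj ?D)\<^sup>*" if "u \<in> cls F x" "v \<in> cls F x" for u v
    using rtrancl_trans[OF conn_sym[OF from_x[OF that(1)]] from_x[OF that(2)]] .
  then show ?thesis
    using cls_self[of x F]
    by (auto simp: mconnected_def reachable_def induced_subgraph_def spanning_subgraph_def adj_def)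
qed

definition tree_classes :: "'e set \<Rightarrow> 'v set set" where
  "tree_classes F = cls F ` (V - cyclic F)"

lemma tau_eq_card_tree_classes:
  assumes F: "F \<subseteq> E"
  shows "tau G F = card (tree_classes F)"
proof -
  let ?I = "induced_subgraph (spanning_subgraph G F)"
  have "is_tree (?I (cls F x)) \<longleftrightarrow> x \<notin> cyclic F" if "x \<in> V" for x
    using mconnected_component is_cycle_component[OF F that] by (simp add: is_tree_def cyclic_def)
  then have "{H \<in> components (spanning_subgraph G F). is_tree H} = ?I ` tree_classes F"
    unfolding components_spanning[OF F] tree_classes_def by auto
  moreover have "inj_on ?I (tree_classes F)"
  proof (rule inj_onI)
    fix X Y assume "?I X = ?I Y"
    then have "mverts (?I X) = mverts (?I Y)" by simp
    then show "X = Y" by (simp add: induced_subgraph_def)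
  qed
  ultimately show ?thesis unfolding tau_def by (simp add: card_image)
qed

lemma tau_eq_0_iff:
  assumes "F \<subseteq> E"
  shows "tau G F = 0 \<longleftrightarrow> V \<subseteq> cyclic F"
  using tau_eq_card_tree_classes[OF assms] finite_V by (auto simp: tree_classes_def)

lemma tau_le_card: "F \<subseteq> E \<Longrightarrow> tau G F \<le> card V"
  using tau_eq_card_tree_classes[of F] finite_V card_image_le[of "V - cyclic F" "cls F"]
    card_mono[of V "V - cyclic F"] by (simp add: tree_classes_def)

lemma tau_empty: "tau G {} = card V"
proof -
  have "cyclic {} = {}" by (auto simp: cyclic_def cycle_at_def cycle_walk_def)
  then have "tree_classes {} = (\<lambda>x. {x}) ` V" by (simp add: tree_classes_def cls_empty)
  then show ?thesis using tau_eq_card_tree_classes[of "{}"] by (simp add: card_image inj_on_def)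
qed

lemma unicyclic_iff: "unicyclic G B \<longleftrightarrow> B \<subseteq> E \<and> (\<forall>x\<in>V. \<exists>!C. cycle_at B x C)"
proof (cases "B \<subseteq> E")
  case True
  have "(\<exists>!C. is_cycle (induced_subgraph (spanning_subgraph G B) (cls B x)) C) \<longleftrightarrow>
      (\<exists>!C. cycle_at B x C)" if "x \<in> V" for x
    using is_cycle_component[OF True that] by simp
  then show ?thesis using True by (simp add: unicyclic_def components_spanning)
qed (simp add: unicyclic_def)

section \<open>The effect of one additional edge\<close>

lemma cls_insert_edge:
  assumes e: "ends e = {u, v}"
  shows "cls (insert e F) x =
    (if x \<in> cls F u \<union> cls F v then cls F u \<union> cls F v else cls F x)"
proof -
  let ?F = "insert e F" and ?M = "cls F u \<union> cls F v"
  have adj: "(y, z) \<in> adj ?F \<longleftrightarrow> (y, z) \<in> adj F \<or> (y = u \<and> z = v) \<or> (y = v \<and> z = u)" for y z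
    using e by (auto simp: adj_def doubleton_eq_iff)
  have stay: "z \<in> cls F w" if "y \<in> cls F w" "(y, z) \<in> adj F" for w y z
    using that by (auto simp: cls_def intro: rtrancl_into_rtrancl)
  have uv: "v \<in> cls ?F u" using adj by (auto simp: cls_def)
  have "?M \<subseteq> cls ?F u"
    using cls_mono[of F ?F u] cls_mono[of F ?F v] cls_eq[OF uv] by auto
  moreover have "cls ?F u \<subseteq> ?M"
  proof
    fix y assume "y \<in> cls ?F u"
    then have "(u, y) \<in> (adj ?F)\<^sup>*" by (simp add: cls_def)
    then show "y \<in> ?M"
      by (induction rule: rtrancl_induct) (use stay adj cls_self in auto)
  qed
  ultimately have M: "cls ?F u = ?M" by blast
  show ?thesis
  proof (cases "x \<in> ?M")
    case True
    then show ?thesis using M cls_eq[of x ?F u] by simp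
  next
    case False
    have "cls ?F x \<subseteq> cls F x"
    proof
      fix y assume "y \<in> cls ?F x"
      then have "(x, y) \<in> (adj ?F)\<^sup>*" by (simp add: cls_def)
      then show "y \<in> cls F x"
      proof (induction rule: rtrancl_induct)
        case (step y z)
        have "y \<noteq> u" "y \<noteq> v" using step.IH False cls_eq cls_self by blast+
        then have "(y, z) \<in> adj F" using step.hyps(2) adj by simp
        then show ?case using stay step.IH by blast
      qed (simp add: cls_self)
    qed
    then show ?thesis using cls_mono[of F ?F x] False by auto
  qed
qed

lemma cycle_walk_avoiding:
  assumes "cycle_walk F vs es" "e \<notin> set es"
  shows "cycle_walk (F - {e}) vs es"
  using assms by (auto simp: cycle_walk_def)

text \<open>A cycle through \<open>e\<close> needs a connection of \<open>u\<close> and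
  \<open>v\<close> in \<open>F\<close>, by going round the other way; a cycle avoiding
  \<open>e\<close> is already one of \<open>F\<close>. So the joined class is cyclic exactly when
  \<open>e\<close> closes a cycle or one side had one.\<close>

lemma cyclic_insert_edge:
  assumes F: "F \<subseteq> E" and e: "e \<in> E" "e \<notin> F" "ends e = {u, v}"
  shows "cyclic (insert e F) = cyclic F \<union>
    (if v \<in> cls F u \<or> u \<in> cyclic F \<or> v \<in> cyclic F then cls F u \<union> cls F v else {})"
    (is "_ = _ \<union> (if ?P then ?M else {})")
proof -
  let ?F = "insert e F"
  have M: "cls ?F u = ?M" using cls_insert_edge[OF e(3)] cls_self by simp
  have "v \<in> cls ?F u" using M cls_self by simp
  have "u \<in> cyclic ?F" if ?P
  proof -
    have "u \<in> cyclic ?F" if "v \<in> cls F u"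
      using cycle_through_edge[OF F e] that by (auto simp: cls_def cyclic_def)
    then show ?thesis
      using \<open>?P\<close> cyclic_mono[of F ?F] cyclic_cls[OF \<open>v \<in> cls ?F u\<close>] by blast
  qed
  then have "?M \<subseteq> cyclic ?F" if ?P using that M cyclic_cls[of _ ?F u] by blast
  moreover have "cyclic F \<subseteq> cyclic ?F" by (rule cyclic_mono) auto
  moreover have "x \<in> cyclic F \<or> (?P \<and> x \<in> ?M)" if x: "x \<in> cyclic ?F" for x
  proof -
    obtain vs es where w: "cycle_walk ?F vs es" "set vs \<subseteq> cls ?F x"
      using x by (auto simp: cyclic_def cycle_at_def)
    show ?thesis
    proof (cases "e \<in> set es")
      case True
      have c: "cycle_at ?F x (set es)" using w by (auto simp: cycle_at_def)
      have "?F - {e} = F" using e by auto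
      then have "v \<in> cls F u" using cycle_edge_bypass(1)[OF c True e(3)] by (simp add: cls_def)
      moreover have "x \<in> cls ?F u"
        using cycle_edge_bypass(2)[OF c True e(3)] cls_eq cls_self by blast
      ultimately show ?thesis using M by blast
    next
      case False
      have "?F - {e} = F" using e by auto
      then have wF: "cycle_walk F vs es" using cycle_walk_avoiding[OF w(1) False] by simp
      then have h: "hd vs \<in> cyclic F"
        using cycle_walk_connected[OF wF] unfolding cyclic_def cycle_at_def by blast
      have hx: "hd vs \<in> cls ?F x" using w by (auto simp: cycle_walk_def)
      show ?thesis
      proof (cases "x \<in> ?M")
        case True
        then have "hd vs \<in> ?M" using hx cls_insert_edge[OF e(3), of F x] by simp
        then show ?thesis using True h cyclic_cls by blast
      next
        case False
        then have "hd vs \<in> cls F x" using hx cls_insert_edge[OF e(3), of F x] by simp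
        then show ?thesis using h cyclic_cls by blast
      qed
    qed
  qed
  ultimately show ?thesis by (auto split: if_splits)
qed

text \<open>If both ends lie in cyclic classes, no tree is touched. Otherwise exactly one tree is
  lost: it acquires a cycle, it is attached to a cyclic component, or two trees merge into
  one.\<close>

lemma tau_insert_edge:
  assumes F: "F \<subseteq> E" and e: "e \<in> E" "e \<notin> F"
  shows "tau G F = tau G (insert e F) + (if ends e \<subseteq> cyclic F then 0 else 1)"
proof -
  obtain u v where uv: "ends e = {u, v}" "u \<in> V" "v \<in> V" using ends_pair[OF e(1)] by blast
  let ?F = "insert e F" and ?M = "cls F u \<union> cls F v"
  note cyc = cyclic_insert_edge[OF F e uv(1)] and cl = cls_insert_edge[OF uv(1), of F]
  have fin: "finite (cls F ` X)" if "X \<subseteq> V" for X using that finite_V finite_subset by blast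
  have M: "?M \<subseteq> V" using cls_subset_V[OF F] uv by blast
  have tau: "tau G F = card (tree_classes F)" "tau G ?F = card (tree_classes ?F)"
    using tau_eq_card_tree_classes F e by auto
  have out: "cls F w \<notin> cls F ` X" if "X \<inter> cls F w = {}" for w X
    using that cls_eq_iff[of F w] by auto
  \<comment> \<open>In case \<open>one\<close>, \<open>cls F w\<close> is the tree that disappears;
    when both ends lie in the same tree, \<open>w\<close> is \<open>u\<close>.\<close>
  consider (both) "u \<in> cyclic F" "v \<in> cyclic F"
    | (one) w where "w \<in> {u, v}" "w \<notin> cyclic F" "?M - cyclic F = cls F w"
        "v \<in> cls F u \<or> u \<in> cyclic F \<or> v \<in> cyclic F"
    | (none) "u \<notin> cyclic F" "v \<notin> cyclic F" "v \<notin> cls F u"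
  proof -
    have out: "cls F w \<inter> cyclic F = {}" if "w \<notin> cyclic F" for w using that cyclic_cls by blast
    have inn: "cls F w \<subseteq> cyclic F" if "w \<in> cyclic F" for w using that cyclic_cls by blast
    show ?thesis
    proof (cases "u \<in> cyclic F")
      case True
      then show ?thesis using both one[of v] out[of v] inn[of u] by blast
    next
      case False
      show ?thesis
      proof (cases "v \<in> cyclic F")
        case True
        then show ?thesis using False one[of u] out[of u] inn[of v] by blast
      next
        case v: False
        show ?thesis
        proof (cases "v \<in> cls F u")
          case True
          then show ?thesis using False one[of u] out[of u] cls_eq[OF True] by blast
        qed (use False v none in blast)
      qed
    qed
  qed
  then show ?thesis
  proof cases
    case both
    then have M: "?M \<subseteq> cyclic F" using cyclic_cls by blast
    then have "cyclic ?F = cyclic F" using cyc by auto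
    moreover have "cls ?F x = cls F x" if "x \<notin> cyclic F" for x using that M cl[of x] by auto
    ultimately have "tree_classes ?F = tree_classes F" by (auto simp: tree_classes_def)
    then show ?thesis using tau both uv by simp
  next
    case one
    have cyc': "cyclic ?F = cyclic F \<union> ?M" using cyc one(4) by auto
    let ?X = "V - cyclic F - ?M"
    have w: "cls F w \<subseteq> ?M" using one(1) by auto
    have "cls ?F x = cls F x" if "x \<in> ?X" for x using that cl[of x] by auto
    then have 1: "tree_classes ?F = cls F ` ?X"
      unfolding tree_classes_def cyc' by (auto simp: image_iff)
    have split: "V - cyclic F = ?X \<union> cls F w" using M one(3) by blast
    have 2: "tree_classes F = insert (cls F w) (cls F ` ?X)"
      unfolding tree_classes_def by (subst split) (simp add: image_Un cls_image_cls)
    have "cls F w \<notin> cls F ` ?X" using w by (intro out) auto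
    then have "card (tree_classes F) = Suc (card (tree_classes ?F))"
      unfolding 1 2 using fin[of ?X] by (subst card_insert_disjoint) auto
    then show ?thesis using tau one uv by auto
  next
    case none
    have cyc': "cyclic ?F = cyclic F" using cyc none by simp
    define X where "X = V - cyclic F - ?M"
    have fX: "finite (cls F ` X)" by (rule fin) (auto simp: X_def)
    have Mc: "?M \<inter> cyclic F = {}" using none cyclic_cls by blast
    have split: "V - cyclic F = X \<union> ?M" unfolding X_def using M Mc by blast
    have "cls ?F ` X = cls F ` X" using cl by (intro image_cong) (auto simp: X_def)
    moreover have "cls ?F ` ?M = {?M}" using cl cls_self[of u F] by auto
    ultimately have 1: "tree_classes ?F = insert ?M (cls F ` X)"
      unfolding tree_classes_def cyc' by (subst split) (simp add: image_Un)
    have 2: "tree_classes F = insert (cls F u) (insert (cls F v) (cls F ` X))"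
      unfolding tree_classes_def by (subst split) (simp add: image_Un cls_image_cls insert_commute)
    have n1: "?M \<notin> cls F ` X" using cls_self[of _ F] by (auto simp: X_def)
    have n2: "cls F v \<notin> cls F ` X" by (rule out) (auto simp: X_def)
    have n3: "cls F u \<notin> insert (cls F v) (cls F ` X)"
      using out[of X u] none(3) cls_eq_iff[of F u v] by (auto simp: X_def)
    have "card (tree_classes F) = Suc (Suc (card (cls F ` X)))"
      unfolding 2 using n2 n3 fX by (subst card_insert_disjoint, auto)+
    moreover have "card (tree_classes ?F) = Suc (card (cls F ` X))"
      unfolding 1 using n1 fX by (subst card_insert_disjoint) auto
    ultimately show ?thesis using tau none uv by auto
  qed
qed

section \<open>Unicyclic subgraphs as bases\<close>

text \<open>Intersecting with \<open>E\<close> makes the rank laws hold for arbitrary sets, as the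
  locale demands. The subtraction does not truncate, by \<open>tau_le_card\<close>.\<close>

definition rk :: "'e set \<Rightarrow> nat" where
  "rk X = card V - tau G (X \<inter> E)"

lemma rk_insert_edge:
  assumes "F \<subseteq> E" "e \<in> E"
  shows "rk (insert e F) = rk F + (if e \<in> F \<or> ends e \<subseteq> cyclic F then 0 else 1)"
proof (cases "e \<in> F")
  case False
  have "insert e F \<inter> E = insert e F" "F \<inter> E = F" using assms by auto
  then show ?thesis
    using tau_insert_edge[OF assms False] tau_le_card[OF assms(1)] False by (auto simp: rk_def)
qed (simp add: insert_absorb)

sublocale matroid_rank E rk
proof (rule matroid_rank_from_gains)
  show "rk {} = 0" by (simp add: rk_def tau_empty)
  show "rk (X \<inter> E) = rk X" for X by (simp add: rk_def)
  show "rk (insert e F) = rk F + (if e \<in> F \<union> {e. ends e \<subseteq> cyclic F} then 0 else 1)"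
    if "F \<subseteq> E" "e \<in> E" for F e
    using rk_insert_edge[OF that] by simp
  show "F \<union> {e. ends e \<subseteq> cyclic F} \<subseteq> F' \<union> {e. ends e \<subseteq> cyclic F'}" if "F \<subseteq> F'" for F F'
    using that cyclic_mono[OF that] by auto
qed (rule finite_E)

lemma rk_eq_card_V_iff:
  assumes "F \<subseteq> E"
  shows "rk F = card V \<longleftrightarrow> V \<subseteq> cyclic F"
proof -
  have "F \<inter> E = F" using assms by auto
  then show ?thesis
    using tau_le_card[OF assms] tau_eq_0_iff[OF assms] by (auto simp: rk_def)
qed

text \<open>Given two cycles in a component, an edge of one outside the other is redundant: its ends
  stay connected along the rest of its cycle, and the other cycle survives. Then \<open>rk B\<close>
  would be smaller than \<open>card B\<close>.\<close>

lemma base_imp_unicyclic: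
  assumes B: "B \<subseteq> E" "rk B = card V" "card B = card V"
  shows "unicyclic G B"
proof -
  have all: "V \<subseteq> cyclic B" using rk_eq_card_V_iff B by blast
  have sub: "C1 \<subseteq> C2" if x: "x \<in> V" and C: "cycle_at B x C1" "cycle_at B x C2" for x C1 C2
  proof
    fix e assume e: "e \<in> C1"
    show "e \<in> C2"
    proof (rule ccontr)
      assume not: "e \<notin> C2"
      have eB: "e \<in> B" using e C by (auto simp: cycle_at_def cycle_walk_def)
      let ?F = "B - {e}"
      have FE: "?F \<subseteq> E" "e \<in> E" and BF: "insert e ?F = B" using B eB by auto
      obtain u v where uv: "ends e = {u, v}" using ends_pair[OF FE(2)] by blast
      have vu: "v \<in> cls ?F u" using cycle_edge_bypass(1)[OF C(1) e uv] by (simp add: cls_def)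
      have cl: "cls B y = cls ?F y" for y
        using cls_insert_edge[OF uv, of ?F y] cls_eq[OF vu] cls_eq[of y ?F u] unfolding BF
        by (auto split: if_splits)
      obtain vs es where w: "cycle_walk B vs es" "set vs \<subseteq> cls B x" "C2 = set es"
        using C(2) by (auto simp: cycle_at_def)
      then have "cycle_walk ?F vs es" using cycle_walk_avoiding not by blast
      then have "x \<in> cyclic ?F" using w(2) cl by (auto simp: cyclic_def cycle_at_def)
      moreover have "u \<in> cls ?F x" using cycle_edge_bypass(2)[OF C(1) e uv] cl by simp
      ultimately have "ends e \<subseteq> cyclic ?F" using uv cyclic_cls[OF vu] cyclic_cls[of u ?F x] by simp
      then have "rk B = rk ?F" using rk_insert_edge[OF FE] BF by simp
      also have "\<dots> \<le> card ?F" using B finite_E by (intro r_le_card) (auto intro: finite_subset)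
      also have "\<dots> < card B" using eB B finite_E by (meson card_Diff1_less finite_subset)
      finally show False using B by simp
    qed
  qed
  have "\<exists>!C. cycle_at B x C" if x: "x \<in> V" for x
  proof -
    obtain C where "cycle_at B x C" using all x by (auto simp: cyclic_def)
    then show ?thesis using sub[OF x] by blast
  qed
  then show ?thesis using B by (simp add: unicyclic_iff)
qed

text \<open>The rank is full because no component is a tree. If an edge \<open>e\<close> were
  redundant, all components would keep a cycle after its deletion; either \<open>e\<close> closes a
  second one, or the two sides of \<open>e\<close> have one each, against uniqueness in the
  component of \<open>e\<close>.\<close>

lemma unicyclic_imp_base:
  assumes "unicyclic G B"
  shows "B \<subseteq> E" "rk B = card V" "card B = card V"
proof -
  have B: "B \<subseteq> E" and ex: "\<And>x. x \<in> V \<Longrightarrow> \<exists>!C. cycle_at B x C"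
    using assms by (auto simp: unicyclic_iff)
  show "B \<subseteq> E" by fact
  have "V \<subseteq> cyclic B" unfolding cyclic_def using ex by blast
  then show rB: "rk B = card V" using rk_eq_card_V_iff[OF B] by simp
  have "rk B = card B"
  proof (rule r_eq_card_if_no_redundant_element)
    show "finite B" using B finite_E finite_subset by blast
    fix e assume e: "e \<in> B"
    let ?F = "B - {e}"
    have FE: "?F \<subseteq> E" "e \<in> E" "e \<notin> ?F" and BF: "insert e ?F = B" and FB: "?F \<subseteq> B" using B e by auto
    obtain u v where uv: "ends e = {u, v}" "u \<in> V" "v \<in> V" using ends_pair[OF FE(2)] by blast
    show "rk ?F \<noteq> rk B"
    proof
      assume "rk ?F = rk B"
      then have all: "V \<subseteq> cyclic ?F" using rk_eq_card_V_iff[OF FE(1)] rB by simp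
      obtain C1 where C1: "cycle_at ?F u C1" using all uv by (auto simp: cyclic_def)
      obtain C2 where C2: "cycle_at ?F v C2" using all uv by (auto simp: cyclic_def)
      have "v \<in> cls B u"
        using cls_insert_edge[OF uv(1), of ?F u] cls_self[of u ?F] cls_self[of v ?F] unfolding BF by simp
      then have B12: "cycle_at B u C1" "cycle_at B u C2"
        using cycle_at_mono[OF FB] C1 C2 cycle_at_cls by blast+
      show False
      proof (cases "v \<in> cls ?F u")
        case True
        then obtain C where C: "cycle_at B u C" "e \<in> C"
          using cycle_through_edge[OF FE uv(1)] BF by (auto simp: cls_def)
        have "e \<notin> C1" using C1 by (auto simp: cycle_at_def cycle_walk_def)
        then show False using ex[OF uv(2)] C B12(1) by blast
      next
        case False
        \<comment> \<open>Uniqueness identifies the cycles on the two sides of \<open>e\<close>, so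
          an end of one of their edges would lie in both classes.\<close>
        have "C1 = C2" using ex[OF uv(2)] B12 by blast
        moreover obtain f where f: "f \<in> C1"
          using C1 by (auto simp: cycle_at_def cycle_walk_def) (metis hd_in_set length_0_conv)
        moreover have "f \<in> E" using f C1 FE(1) by (auto simp: cycle_at_def cycle_walk_def)
        moreover obtain a b where "ends f = {a, b}" using ends_pair[OF \<open>f \<in> E\<close>] by blast
        ultimately have "a \<in> cls ?F u" "a \<in> cls ?F v"
          using cycle_edge_bypass(2)[OF C1] cycle_edge_bypass(2)[OF C2] by blast+
        then show False using False cls_eq cls_self by metis
      qed
    qed
  qed
  then show "card B = card V" using rB by simp
qed

lemma has_disjoint_rainbow_unicyclic_iff:
  assumes "rk E = card V"
  shows "has_disjoint_rainbow_unicyclic G c t \<longleftrightarrow> has_rainbow_bases c t"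
proof -
  have "unicyclic G B \<longleftrightarrow> is_base B" for B
    using base_imp_unicyclic[of B] unicyclic_imp_base[of B] assms by (auto simp: is_base_def)
  then show ?thesis
    by (simp add: has_disjoint_rainbow_unicyclic_def has_rainbow_bases_def rainbow_def)
qed

text \<open>Connectedness joins every vertex to the given cycle, so there is no tree component. This
  makes \<open>tau G F\<close> the corank of \<open>F\<close>.\<close>

lemma rk_E_eq_card_V:
  assumes "mconnected G" "is_cycle G C"
  shows "rk E = card V"
proof -
  obtain vs es where w: "cycle_walk E vs es"
    using assms(2) by (auto simp: is_cycle_def cycle_walk_def)
  then have "hd vs \<in> V" by (auto simp: cycle_walk_def)
  have "x \<in> cyclic E" if "x \<in> V" for x
  proof -
    have "(x, hd vs) \<in> reachable G" using assms(1) that \<open>hd vs \<in> V\<close> by (auto simp: mconnected_def)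
    then have "hd vs \<in> cls E x" by (auto simp: reachable_def cls_def adj_def)
    then show ?thesis using w cycle_walk_connected[OF w] cls_eq by (auto simp: cyclic_def cycle_at_def)
  qed
  then show ?thesis using rk_eq_card_V_iff by blast
qed

end

theorem theorem14:
  fixes G :: "('v, 'e) mgraph" and t :: nat
  assumes "multigraph G"
    and "mconnected G"
    and "\<exists>C. is_cycle G C"
    and "card (mverts G) \<ge> 2"
    and "t \<ge> 1"
  shows "((\<exists>F\<^sub>0. F\<^sub>0 \<subseteq> medges G \<and> card (medges G) - card F\<^sub>0 < t * tau G F\<^sub>0) \<longrightarrow>
            ar_bc G t = card (medges G)) \<and>
         (\<not> (\<exists>F\<^sub>0. F\<^sub>0 \<subseteq> medges G \<and> card (medges G) - card F\<^sub>0 < t * tau G F\<^sub>0) \<longrightarrow>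
            ar_bc G t =
              Max {card F + t * (tau G F - 1) | F. F \<subseteq> medges G \<and> tau G F \<ge> 2})"
proof -
  interpret fixed_multigraph G using assms(1) by unfold_locales
  have rkE: "rk E = card V" using rk_E_eq_card_V assms(2,3) by blast
  have tau: "tau G F = rk E - rk F" if "F \<subseteq> E" for F
  proof -
    have "F \<inter> E = F" using that by auto
    then show ?thesis using rkE tau_le_card[OF that] by (simp add: rk_def)
  qed
  let ?A = "{m. \<exists>c :: 'e \<Rightarrow> nat. card (c ` E) = m \<and> \<not> has_rainbow_bases c t}"
  have ar: "ar_bc G t = Max ?A"
    by (simp add: ar_bc_def has_disjoint_rainbow_unicyclic_iff[OF rkE])
  have bound: "m \<le> card E" if "m \<in> ?A" for m using that finite_E card_image_le by auto
  then have finA: "finite ?A" using finite_nat_set_iff_bounded_le by blast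
  show ?thesis
  proof (intro conjI impI)
    assume "\<exists>F\<^sub>0. F\<^sub>0 \<subseteq> E \<and> card E - card F\<^sub>0 < t * tau G F\<^sub>0"
    then obtain F where F: "F \<subseteq> E" "card E - card F < t * (rk E - rk F)" using tau by auto
    obtain h :: "'e \<Rightarrow> nat" where h: "inj_on h E" using finite_E finite_imp_inj_to_nat_seg by metis
    have "card (h ` E) = card E" using h by (rule card_image)
    then have "card E \<in> ?A" using no_disjoint_bases[OF F, of h] by blast
    then show "ar_bc G t = card E" unfolding ar using finA bound by (intro Max_eqI) auto
  next
    assume "\<not> (\<exists>F\<^sub>0. F\<^sub>0 \<subseteq> E \<and> card E - card F\<^sub>0 < t * tau G F\<^sub>0)"
    then have pack: "t * (rk E - rk F) \<le> card E - card F" if "F \<subseteq> E" for F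
      using that tau by (metis not_le)
    let ?S = "{card F + t * (tau G F - 1) | F. F \<subseteq> E \<and> tau G F \<ge> 2}"
    have "?S = (\<lambda>F. card F + t * (tau G F - 1)) ` {F \<in> Pow E. tau G F \<ge> 2}" by auto
    then have finS: "finite ?S" using finite_E by simp
    \<comment> \<open>Two vertices make the empty edge set admissible, so the maximum is not over an
      empty set.\<close>
    have "tau G {} \<ge> 2" using tau_empty assms(4) by simp
    then have neS: "?S \<noteq> {}" by blast
    have SA: "?S \<subseteq> ?A"
    proof
      fix m assume "m \<in> ?S"
      then obtain F where F: "F \<subseteq> E" "tau G F \<ge> 2" "m = card F + t * (tau G F - 1)" by auto
      then show "m \<in> ?A"
        using colouring_without_rainbow_bases[OF assms(5) F(1) _ pack[OF F(1)]] tau[OF F(1)] by auto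
    qed
    \<comment> \<open>More than \<open>Max ?S\<close> colours is precisely the strict inequality for
      all sets of corank at least two that forces rainbow bases.\<close>
    have up: "m \<le> Max ?S" if m: "m \<in> ?A" for m
    proof (rule ccontr)
      assume not: "\<not> m \<le> Max ?S"
      obtain c :: "'e \<Rightarrow> nat" where c: "card (c ` E) = m" "\<not> has_rainbow_bases c t"
        using m by blast
      have "card F + t * (rk E - rk F - 1) < card (c ` E)" if "F \<subseteq> E" "rk E - rk F \<ge> 2" for F
      proof -
        have "card F + t * (rk E - rk F - 1) \<in> ?S"
          using that tau[OF that(1)] by (intro CollectI exI[of _ F]) simp
        from Max_ge[OF finS this] show ?thesis using not c(1) by linarith
      qed
      then show False using has_rainbow_bases_if_many_colours[OF assms(5) pack] c(2) by blast
    qed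
    have "Max ?S \<in> ?A" using Max_in[OF finS neS] SA by blast
    then show "ar_bc G t = Max ?S" unfolding ar using finA up by (intro Max_eqI) auto
  qed
qed

end
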